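(* Let $\Omega \subset \mathbb{R}^2$ be a bounded domain, and fix $f \in L^2(\Omega)$, $\psi \in C(\overline{\Omega})$ and $g_D \in C(\overline{\Omega})$ with $g_D \geq \psi$. Let $X = \{ v \in H^1(\Omega) : v = g_D \text{ on } \partial\Omega\}$ and $$K_\psi = \{ v \in X : v \geq \psi \}.$$ Then, for $u \in K_\psi$, the following statements (a) and (b) are equivalent: (a) $u$ is a solution of the energy minimization formulation: $u$ minimizes $$I(v) = \int_\Omega \tfrac{1}{2} |\nabla v|^2 - f v$$ over $v \in K_\psi$. (b) $u$ is a solution of the variational inequality formulation: $$\int_\Omega \nabla u \cdot \nabla (v - u) \geq \int_\Omega f (v - u) \quad \text{for all } v \in K_\psi.$$ If also $u \in C(\overline{\Omega}) \cap C^2(\Omega)$ (that is, $u$ is a classical solution), then (a) or (b) implies (c) $u$ is a solution of the complementarity problem formulation: the following hold almost everywhere in $\Omega$, $$-\nabla^2 u - f \geq 0, \qquad u - \psi \geq 0, \qquad (-\nabla^2 u - f)(u - \psi) = 0.$$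
   Context: $H^1(\Omega)$ is the Sobolev space of functions $u : \Omega \to \mathbb{R}$ such that $u$, $\partial u/\partial x$ and $\partial u/\partial y$ are in $L^2(\Omega)$. The operator $\nabla^2$ is the Laplacian. These are formulations of the classical obstacle problem, with obstacle $\psi$, load (source term) $f$ and Dirichlet boundary data $g_D$; $K_\psi$ is the set of admissible functions. *)

theory Defs
  imports "HOL-Analysis.Analysis"
begin

text \<open>Real-valued functions on a subset of Euclidean space are represented by total functions;
  only their values on the set (or on its closure, where stated) matter. Elements of
  Lebesgue and Sobolev spaces are represented by functions rather than by equivalence classes,
  so (in)equalities between them are understood almost everywhere.\<close>

definition bounded_domain :: "(real^'n) set \<Rightarrow> bool" where
  "bounded_domain \<Omega> \<longleftrightarrow> open \<Omega> \<and> connected \<Omega> \<and> \<Omega> \<noteq> {} \<and> bounded \<Omega>"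

definition partial_deriv :: "'n \<Rightarrow> (real^'n \<Rightarrow> real) \<Rightarrow> real^'n \<Rightarrow> real" where
  "partial_deriv i f x = frechet_derivative f (at x) (axis i 1)"

text \<open>Intended for open \<open>S\<close>, where differentiability with continuous partial derivatives is
  the same as existence and continuity of the partial derivatives.\<close>

fun Ck_on :: "nat \<Rightarrow> (real^'n) set \<Rightarrow> (real^'n \<Rightarrow> real) \<Rightarrow> bool" where
  "Ck_on 0 S f \<longleftrightarrow> continuous_on S f"
| "Ck_on (Suc k) S f \<longleftrightarrow> (\<forall>x\<in>S. f differentiable (at x)) \<and> (\<forall>i. Ck_on k S (partial_deriv i f))"

definition laplacian :: "(real^'n \<Rightarrow> real) \<Rightarrow> real^'n \<Rightarrow> real" where
  "laplacian u x = (\<Sum>i\<in>UNIV. partial_deriv i (partial_deriv i u) x)"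

definition test_functions :: "(real^'n) set \<Rightarrow> (real^'n \<Rightarrow> real) set" where
  "test_functions \<Omega> =
     {\<phi>. (\<forall>k. Ck_on k UNIV \<phi>) \<and> compact (closure {x. \<phi> x \<noteq> 0}) \<and> closure {x. \<phi> x \<noteq> 0} \<subseteq> \<Omega>}"

definition L2 :: "(real^'n) set \<Rightarrow> (real^'n \<Rightarrow> real) set" where
  "L2 \<Omega> = {u \<in> borel_measurable (lebesgue_on \<Omega>). integrable (lebesgue_on \<Omega>) (\<lambda>x. (u x)\<^sup>2)}"

definition has_weak_partial ::
    "(real^'n) set \<Rightarrow> 'n \<Rightarrow> (real^'n \<Rightarrow> real) \<Rightarrow> (real^'n \<Rightarrow> real) \<Rightarrow> bool" where
  "has_weak_partial \<Omega> i u g \<longleftrightarrow>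
     (\<forall>\<phi>\<in>test_functions \<Omega>.
        (LINT x|lebesgue_on \<Omega>. u x * partial_deriv i \<phi> x) = - (LINT x|lebesgue_on \<Omega>. g x * \<phi> x))"

definition H1 :: "(real^'n) set \<Rightarrow> (real^'n \<Rightarrow> real) set" where
  "H1 \<Omega> = {u \<in> L2 \<Omega>. \<forall>i. \<exists>g\<in>L2 \<Omega>. has_weak_partial \<Omega> i u g}"

text \<open>Weak derivatives are unique only up to null sets, so a representative is chosen. It is
  meaningful for functions in \<open>H1 \<Omega>\<close>; integrals over \<open>\<Omega>\<close> do not depend on the choice.\<close>

definition weak_partial :: "(real^'n) set \<Rightarrow> 'n \<Rightarrow> (real^'n \<Rightarrow> real) \<Rightarrow> real^'n \<Rightarrow> real" where
  "weak_partial \<Omega> i u = (SOME g. g \<in> L2 \<Omega> \<and> has_weak_partial \<Omega> i u g)"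

definition weak_grad :: "(real^'n) set \<Rightarrow> (real^'n \<Rightarrow> real) \<Rightarrow> real^'n \<Rightarrow> real^'n" where
  "weak_grad \<Omega> u x = (\<chi> i. weak_partial \<Omega> i u x)"

definition H1_norm :: "(real^'n) set \<Rightarrow> (real^'n \<Rightarrow> real) \<Rightarrow> real" where
  "H1_norm \<Omega> u = sqrt (LINT x|lebesgue_on \<Omega>. (u x)\<^sup>2 + (norm (weak_grad \<Omega> u x))\<^sup>2)"

definition H1_0 :: "(real^'n) set \<Rightarrow> (real^'n \<Rightarrow> real) set" where
  "H1_0 \<Omega> = {v \<in> H1 \<Omega>. \<exists>\<phi>. (\<forall>n. \<phi> n \<in> test_functions \<Omega>) \<and>
                   (\<lambda>n. H1_norm \<Omega> (\<lambda>x. v x - \<phi> n x)) \<longlonglongrightarrow> 0}"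

text \<open>Boundary values of Sobolev functions. No regularity of the boundary is assumed, so there
  need not be a trace operator, and the continuous boundary datum \<open>g\<close> need not itself be in
  \<open>H1 \<Omega>\<close>. The condition \<open>v = g\<close> on the boundary means that \<open>v\<close> is in the \<open>H1\<close>-closure of the
  functions in \<open>H1 \<Omega>\<close> that are continuous up to the boundary and equal \<open>g\<close> there; that closure is
  \<open>w + H1_0 \<Omega>\<close> for any such function \<open>w\<close>. On Lipschitz domains this says that the trace of \<open>v\<close>
  is \<open>g\<close>.\<close>

definition has_boundary_values ::
    "(real^'n) set \<Rightarrow> (real^'n \<Rightarrow> real) \<Rightarrow> (real^'n \<Rightarrow> real) \<Rightarrow> bool" where
  "has_boundary_values \<Omega> v g \<longleftrightarrow>
     (\<exists>w\<in>H1 \<Omega>. continuous_on (closure \<Omega>) w \<and> (\<forall>x\<in>frontier \<Omega>. w x = g x) \<and>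
        (\<lambda>x. v x - w x) \<in> H1_0 \<Omega>)"

definition dirichlet_class :: "(real^'n) set \<Rightarrow> (real^'n \<Rightarrow> real) \<Rightarrow> (real^'n \<Rightarrow> real) set" where
  "dirichlet_class \<Omega> g = {v \<in> H1 \<Omega>. has_boundary_values \<Omega> v g}"

definition admissible ::
    "(real^'n) set \<Rightarrow> (real^'n \<Rightarrow> real) \<Rightarrow> (real^'n \<Rightarrow> real) \<Rightarrow> (real^'n \<Rightarrow> real) set" where
  "admissible \<Omega> g \<psi> = {v \<in> dirichlet_class \<Omega> g. AE x in lebesgue_on \<Omega>. v x \<ge> \<psi> x}"

definition energy :: "(real^'n) set \<Rightarrow> (real^'n \<Rightarrow> real) \<Rightarrow> (real^'n \<Rightarrow> real) \<Rightarrow> real" where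
  "energy \<Omega> f v = (LINT x|lebesgue_on \<Omega>. 1/2 * (norm (weak_grad \<Omega> v x))\<^sup>2 - f x * v x)"

definition energy_minimizer ::
    "(real^'n) set \<Rightarrow> (real^'n \<Rightarrow> real) \<Rightarrow> (real^'n \<Rightarrow> real) \<Rightarrow> (real^'n \<Rightarrow> real)
      \<Rightarrow> (real^'n \<Rightarrow> real) \<Rightarrow> bool" where
  "energy_minimizer \<Omega> f g \<psi> u \<longleftrightarrow>
     u \<in> admissible \<Omega> g \<psi> \<and> (\<forall>v\<in>admissible \<Omega> g \<psi>. energy \<Omega> f u \<le> energy \<Omega> f v)"

definition variational_solution ::
    "(real^'n) set \<Rightarrow> (real^'n \<Rightarrow> real) \<Rightarrow> (real^'n \<Rightarrow> real) \<Rightarrow> (real^'n \<Rightarrow> real)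
      \<Rightarrow> (real^'n \<Rightarrow> real) \<Rightarrow> bool" where
  "variational_solution \<Omega> f g \<psi> u \<longleftrightarrow>
     u \<in> admissible \<Omega> g \<psi> \<and>
     (\<forall>v\<in>admissible \<Omega> g \<psi>.
        (LINT x|lebesgue_on \<Omega>. weak_grad \<Omega> u x \<bullet> weak_grad \<Omega> (\<lambda>y. v y - u y) x)
          \<ge> (LINT x|lebesgue_on \<Omega>. f x * (v x - u x)))"

definition complementarity_solution ::
    "(real^'n) set \<Rightarrow> (real^'n \<Rightarrow> real) \<Rightarrow> (real^'n \<Rightarrow> real) \<Rightarrow> (real^'n \<Rightarrow> real) \<Rightarrow> bool" where
  "complementarity_solution \<Omega> f \<psi> u \<longleftrightarrow>
     (AE x in lebesgue_on \<Omega>.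
        - laplacian u x - f x \<ge> 0 \<and> u x - \<psi> x \<ge> 0 \<and> (- laplacian u x - f x) * (u x - \<psi> x) = 0)"

end

theory Submission
  imports Defs
begin

text \<open>The admissible set is convex and the energy is quadratic along segments,
  \<open>I (u + t d) = I u + t (\<integral> \<nabla>u \<bullet> \<nabla>d - \<integral> f d) + t\<^sup>2/2 \<integral> |\<nabla>d|\<^sup>2\<close>; its one-sided derivative at \<open>t = 0\<close>
  gives the equivalence of (a) and (b). For (c), insert \<open>v = u + \<phi>\<close> with a test function \<open>\<phi> \<ge> 0\<close>, and
  \<open>v = u - \<delta> \<phi>\<close> with \<open>\<phi>\<close> supported where \<open>u > \<psi>\<close> and \<open>\<delta>\<close> small, into the variational inequality;
  integrating by parts twice and localizing gives the sign of \<open>- \<Delta>u - f\<close>, and its vanishing off the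
  contact set. Weak gradients are chosen representatives, so already their additivity needs the
  fundamental lemma of the calculus of variations, and hence smooth bump functions.\<close>

section \<open>Smooth bump functions\<close>

text \<open>Nothing is assumed about the boundary of \<Omega>, so no trace and no Green formula on
  \<Omega> is available. Every integration by parts is done against a test function: the product
  vanishes near the boundary and extends by zero to all of space, where the integral of a partial
  derivative is zero. Likewise the Dirichlet condition enters only through the fact that
  \<open>H1_0\<close> is closed under linear combinations and contains the test functions. For a
  classical solution \<Delta>u is continuous inside \<Omega> but may blow up at the boundary, so -
  \<Delta>u - f need not be in \<open>L2\<close>. The fundamental lemma is therefore stated for
  locally integrable functions. It is one-sided, because (c) asks for a sign; applied to h and - h
  it also gives uniqueness of weak derivatives. It tests only with values between 0 and 1, and this
  bound is what keeps u - \<delta> \<phi> above the obstacle for an explicit \<delta>. Since boxes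
  suffice for Lebesgue differentiation, the bumps are explicit products of one-variable functions
  and no convolution occurs.\<close>

lemma partial_deriv_eqI:
  "(f has_derivative f') (at x) \<Longrightarrow> partial_deriv i f x = f' (axis i 1)"
  by (metis frechet_derivative_at partial_deriv_def)

lemma partial_deriv_add:
  assumes "f differentiable (at x)" "g differentiable (at x)"
  shows "partial_deriv i (\<lambda>x. f x + g x) x = partial_deriv i f x + partial_deriv i g x"
  using has_derivative_add[OF assms[unfolded frechet_derivative_works]]
  by (simp add: partial_deriv_eqI) (simp add: partial_deriv_def)

lemma partial_deriv_mult:
  assumes "f differentiable (at x)" "g differentiable (at x)"
  shows "partial_deriv i (\<lambda>x. f x * g x) x = f x * partial_deriv i g x + partial_deriv i f x * g x"
  using has_derivative_mult[OF assms[unfolded frechet_derivative_works]]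
  by (simp add: partial_deriv_eqI) (simp add: partial_deriv_def)

lemma partial_deriv_const [simp]: "partial_deriv i (\<lambda>x. c) = (\<lambda>x. 0)"
  by (simp add: fun_eq_iff partial_deriv_eqI[OF has_derivative_const])

lemma has_derivative_eq_on_open:
  assumes "open S" "x \<in> S" "\<And>y. y \<in> S \<Longrightarrow> f y = g y" "(f has_derivative f') (at x)"
  shows "(g has_derivative f') (at x)"
  using has_derivative_transform_within_open[of f f' x UNIV S g] assms by simp

text \<open>Differentiation is local. This is what allows functions extended by zero to be treated
  separately inside \<Omega> and off their support.\<close>

lemma partial_deriv_eq_on_open:
  assumes "open S" "x \<in> S" "\<And>y. y \<in> S \<Longrightarrow> f y = g y" "f differentiable (at x)"
  shows "partial_deriv i f x = partial_deriv i g x" "g differentiable (at x)"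
proof -
  obtain D where D: "(f has_derivative D) (at x)"
    using assms(4) by (auto simp: differentiable_def)
  have "(g has_derivative D) (at x)"
    using has_derivative_eq_on_open[OF assms(1-3) D] by simp
  with D show "partial_deriv i f x = partial_deriv i g x" "g differentiable (at x)"
    by (auto simp: partial_deriv_eqI differentiable_def)
qed

lemma Ck_on_Suc_imp_Ck_on: "Ck_on (Suc k) S f \<Longrightarrow> Ck_on k S f"
proof (induction k arbitrary: f)
  case 0
  then show ?case
    by (auto simp: differentiable_imp_continuous_within continuous_at_imp_continuous_on)
qed auto

lemma Ck_on_const: "Ck_on k UNIV (\<lambda>x. c)"
  by (induction k arbitrary: c) auto

text \<open>On the whole space the sum rule is an identity of functions, so it can be rewritten
  inside the recursive call of \<open>Ck_on\<close>. On a proper subset it would hold only at the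
  points of the set.\<close>

lemma Ck_on_add: "Ck_on k UNIV f \<Longrightarrow> Ck_on k UNIV g \<Longrightarrow> Ck_on k UNIV (\<lambda>x. f x + g x)"
proof (induction k arbitrary: f g)
  case 0
  then show ?case by (simp add: continuous_on_add)
next
  case (Suc k)
  then have "partial_deriv i (\<lambda>x. f x + g x) = (\<lambda>x. partial_deriv i f x + partial_deriv i g x)" for i
    by (simp add: fun_eq_iff partial_deriv_add)
  with Suc show ?case by simp
qed

text \<open>The Leibniz rule contains the undifferentiated factors, so the induction hypothesis has
  to be fed with \<open>f\<close> and \<open>g\<close> themselves one order lower.\<close>

lemma Ck_on_mult: "Ck_on k UNIV f \<Longrightarrow> Ck_on k UNIV g \<Longrightarrow> Ck_on k UNIV (\<lambda>x. f x * g x)"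
proof (induction k arbitrary: f g)
  case 0
  then show ?case by (simp add: continuous_on_mult)
next
  case (Suc k)
  then have "partial_deriv i (\<lambda>x. f x * g x)
      = (\<lambda>x. f x * partial_deriv i g x + partial_deriv i f x * g x)" for i
    by (simp add: fun_eq_iff partial_deriv_mult)
  with Suc show ?case
    using Ck_on_Suc_imp_Ck_on[OF Suc.prems(1)] Ck_on_Suc_imp_Ck_on[OF Suc.prems(2)]
    by (simp add: Ck_on_add)
qed

lemma Ck_on_prod:
  "finite I \<Longrightarrow> (\<And>i. i \<in> I \<Longrightarrow> Ck_on k UNIV (F i)) \<Longrightarrow> Ck_on k UNIV (\<lambda>x. \<Prod>i\<in>I. F i x)"
  by (induction I rule: finite_induct) (auto intro: Ck_on_const Ck_on_mult)

text \<open>The classical function exp(-1/t) is the case m = 0. The powers of 1/t are included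
  because the family is then closed under differentiation up to linear combinations, so a single
  induction over all m gives smoothness.\<close>

definition flat :: "nat \<Rightarrow> real \<Rightarrow> real" where
  "flat m t = (if t > 0 then exp (- inverse t) * inverse t ^ m else 0)"

text \<open>Under s = 1/t this is the decay of s^m / exp s at infinity.\<close>

lemma flat_tendsto_0: "((\<lambda>t. exp (- inverse t) * inverse t ^ m) \<longlongrightarrow> 0) (at_right (0::real))"
proof -
  have "((\<lambda>s::real. s ^ m / exp s) \<longlongrightarrow> 0) at_top"
    by (rule tendsto_power_div_exp_0)
  then have "((\<lambda>t::real. inverse t ^ m / exp (inverse t)) \<longlongrightarrow> 0) (at_right 0)"
    by (rule filterlim_compose[OF _ filterlim_inverse_at_top_right])
  then show ?thesis
    by (simp add: exp_minus divide_inverse mult.commute)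
qed

lemma flat_has_derivative:
  "(flat m has_real_derivative flat (m + 2) t - real m * flat (m + 1) t) (at t)"
proof -
  consider "t > 0" | "t < 0" | "t = 0" by linarith
  then show ?thesis
  proof cases
    case 1
    have "((\<lambda>t. exp (- inverse t) * inverse t ^ m) has_real_derivative
        flat (m + 2) t - real m * flat (m + 1) t) (at t)"
      \<comment> \<open>The power rule produces the exponent m - 1 in natural subtraction, hence the
        separate look at m = 0.\<close>
      using 1 by (auto intro!: derivative_eq_intros simp: flat_def field_simps power2_eq_square)
        (cases m; simp add: field_simps)
    then show ?thesis
      by (rule has_field_derivative_transform_within_open[where S="{0<..}"])
        (use 1 in \<open>auto simp: flat_def\<close>)
  next
    case 2
    have "((\<lambda>t. 0) has_real_derivative flat (m + 2) t - real m * flat (m + 1) t) (at t)"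
      using 2 by (auto simp: flat_def)
    then show ?thesis
      by (rule has_field_derivative_transform_within_open[where S="{..<0}"])
        (use 2 in \<open>auto simp: flat_def\<close>)
  next
    case 3
    have "((\<lambda>h. flat m h / h) \<longlongrightarrow> 0) (at_left 0)"
      by (rule Lim_transform_eventually[OF tendsto_const])
        (auto simp: flat_def eventually_at_filter)
    \<comment> \<open>To the right of 0 the difference quotient is again a member of the family,
      \<open>flat (Suc m)\<close>, so the limit is already known.\<close>
    moreover have "((\<lambda>h. flat m h / h) \<longlongrightarrow> 0) (at_right 0)"
      by (rule Lim_transform_eventually[OF flat_tendsto_0[of "Suc m"]])
        (auto simp: flat_def eventually_at_filter divide_inverse)
    ultimately have "((\<lambda>h. flat m h / h) \<longlongrightarrow> 0) (at 0)"
      by (simp add: filterlim_split_at)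
    then show ?thesis
      using 3 by (simp add: DERIV_def flat_def[of _ 0])
  qed
qed

lemma Ck_on_flat: "Ck_on k UNIV (\<lambda>x. flat m (c * x $ i + d))"
proof (induction k arbitrary: m)
  case 0
  have "continuous_on UNIV (flat m)"
    using DERIV_isCont[OF flat_has_derivative] by (simp add: continuous_at_imp_continuous_on)
  then show ?case
    by (auto intro!: continuous_on_compose2[of UNIV "flat m"] continuous_intros)
next
  case (Suc k)
  have D: "((\<lambda>x. flat m (c * x $ i + d)) has_derivative
     (\<lambda>v. (flat (m + 2) (c * x $ i + d) - real m * flat (m + 1) (c * x $ i + d)) * (c * v $ i))) (at x)" for x :: "real^'a"
    by (rule has_derivative_compose[where g="flat m", OF _ flat_has_derivative[unfolded has_field_derivative_def]])
      (auto intro!: derivative_eq_intros bounded_linear_imp_has_derivative)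
  \<comment> \<open>The difference is written as a sum with coefficient - m so that closure under
    sums, products and constants applies. The orders m + 1 and m + 2 are covered because the
    induction hypothesis holds for every m.\<close>
  have "partial_deriv j (\<lambda>x. flat m (c * x $ i + d)) = 
     (\<lambda>x. (flat (m + 2) (c * x $ i + d) + (- real m) * flat (m + 1) (c * x $ i + d)) * (c * axis j 1 $ i))" for j
    by (simp add: fun_eq_iff partial_deriv_eqI[OF D])
  moreover have "Ck_on k UNIV (\<lambda>x. (flat (m + 2) (c * x $ i + d) + (- real m) * flat (m + 1) (c * x $ i + d)) * (c * axis j 1 $ i))" for j
    by (intro Ck_on_mult Ck_on_add Ck_on_const Suc.IH)
  ultimately show ?case
    using D by (auto simp: differentiable_def)
qed

text \<open>The factor n sits inside the profile: for n > 0 it leaves the set where the bump is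
  positive unchanged, while exp(-1/(n s)) rises to 1 for each s > 0. The bumps thus converge to the
  indicator of the open box and never exceed it.\<close>

definition box_bump :: "nat \<Rightarrow> real^'n \<Rightarrow> real^'n \<Rightarrow> real^'n \<Rightarrow> real" where
  "box_bump n a b x = (\<Prod>i\<in>UNIV. flat 0 (real n * (x $ i - a $ i)) * flat 0 (real n * (b $ i - x $ i)))"

lemma flat_0_bounds: "0 \<le> flat 0 t" "flat 0 t \<le> 1"
  by (auto simp: flat_def)

lemma box_bump_bounds: "0 \<le> box_bump n a b x" "box_bump n a b x \<le> 1"
  by (auto simp: box_bump_def flat_0_bounds intro!: prod_nonneg prod_le_1 mult_le_one)

lemma box_bump_eq_0: "x \<notin> box a b \<Longrightarrow> box_bump n a b x = 0"
proof -
  assume "x \<notin> box a b"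
  then obtain i where "x $ i \<le> a $ i \<or> b $ i \<le> x $ i"
    by (auto simp: mem_box_cart not_less)
  then have "flat 0 (real n * (x $ i - a $ i)) * flat 0 (real n * (b $ i - x $ i)) = 0"
    by (auto simp: flat_def zero_less_mult_iff)
  then show ?thesis
    unfolding box_bump_def by (intro prod_zero) auto
qed

lemma Ck_on_box_bump: "Ck_on k UNIV (box_bump n a b)"
proof -
  have "Ck_on k UNIV (\<lambda>x. \<Prod>i\<in>UNIV. flat 0 (real n * x $ i + (- real n * a $ i))
      * flat 0 ((- real n) * x $ i + real n * b $ i))"
    by (intro Ck_on_prod Ck_on_mult Ck_on_flat finite)
  then show ?thesis
    by (simp add: box_bump_def[abs_def] algebra_simps)
qed

lemma box_bump_test_function:
  assumes "cbox a b \<subseteq> S"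
  shows "box_bump n a b \<in> test_functions S"
proof -
  have "closure {x. box_bump n a b x \<noteq> 0} \<subseteq> cbox a b"
    using box_bump_eq_0 box_subset_cbox by (intro closure_minimal closed_cbox) blast
  moreover from this have "compact (closure {x. box_bump n a b x \<noteq> 0})"
    by (meson bounded_cbox bounded_subset closed_closure compact_eq_bounded_closed)
  ultimately show ?thesis
    using assms by (auto simp: test_functions_def Ck_on_box_bump)
qed

lemma box_bump_tendsto_indicator: "(\<lambda>n. box_bump n a b x) \<longlonglongrightarrow> indicator (box a b) x"
proof (cases "x \<in> box a b")
  case False
  then show ?thesis by (simp add: box_bump_eq_0)
next
  case True
  have *: "(\<lambda>n. flat 0 (real n * t)) \<longlonglongrightarrow> 1" if "t > 0" for t
  proof -
    have "(\<lambda>n. exp (- (inverse (real n) * inverse t))) \<longlonglongrightarrow> exp (- (0 * inverse t))"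
      by (intro tendsto_intros lim_inverse_n)
    then have "(\<lambda>n. exp (- (inverse (real n) * inverse t))) \<longlonglongrightarrow> 1"
      by simp
    \<comment> \<open>The exponential agrees with the flat profile only for n > 0; at n = 0 the
      profile is 0, which does not affect the limit.\<close>
    then show ?thesis
      by (rule Lim_transform_eventually)
        (use that in \<open>auto simp: flat_def eventually_at_top_dense intro!: exI[of _ 0]\<close>)
  qed
  have "(\<lambda>n. box_bump n a b x) \<longlonglongrightarrow> (\<Prod>i\<in>(UNIV::'a set). 1 * 1)"
    unfolding box_bump_def
    by (intro tendsto_prod tendsto_mult *) (use True in \<open>auto simp: mem_box_cart\<close>)
  then show ?thesis
    using True by simp
qed

section \<open>Integration by parts against test functions\<close>

lemma partial_deriv_outside_support:
  assumes "closed K" "\<And>x. x \<notin> K \<Longrightarrow> F x = 0" "x \<notin> K"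
  shows "partial_deriv i F x = 0"
  using partial_deriv_eq_on_open(1)[of "- K" x "\<lambda>_. 0" F i] assms by (simp add: open_Compl)

lemma continuous_compact_support_bounded:
  fixes F :: "'a::topological_space \<Rightarrow> real"
  assumes "continuous_on UNIV F" "compact K" "\<And>x. x \<notin> K \<Longrightarrow> F x = 0"
  obtains B where "\<And>x. \<bar>F x\<bar> \<le> B" "0 \<le> B"
proof -
  have "bounded (F ` K)"
    using assms by (intro compact_imp_bounded compact_continuous_image) (auto intro: continuous_on_subset)
  then obtain B where B: "B > 0" "\<And>x. x \<in> K \<Longrightarrow> \<bar>F x\<bar> \<le> B"
    by (auto simp: bounded_pos)
  then have "\<bar>F x\<bar> \<le> B" for x
    using assms(3)[of x] by (cases "x \<in> K") auto
  then show ?thesis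
    using B(1) by (intro that[of B]) auto
qed

lemma integrable_continuous_compact_support:
  fixes F :: "'a::euclidean_space \<Rightarrow> real"
  assumes "continuous_on UNIV F" "compact K" "\<And>x. x \<notin> K \<Longrightarrow> F x = 0"
  shows "integrable lborel F"
proof -
  have "integrable lborel (\<lambda>x. indicator K x *\<^sub>R F x)"
    using assms by (intro borel_integrable_compact) (auto intro: continuous_on_subset)
  moreover have "(\<lambda>x. indicator K x *\<^sub>R F x) = F"
    using assms(3) by (intro ext) (auto simp: indicator_def)
  ultimately show ?thesis
    by metis
qed

text \<open>Restriction to a coordinate line makes the one-variable mean value theorem and
  difference quotients available for partial derivatives.\<close>

lemma has_real_derivative_along_axis:
  assumes "F differentiable (at (x + axis i t))"
  shows "((\<lambda>t. F (x + axis i t)) has_real_derivative partial_deriv i F (x + axis i t)) (at t)"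
proof -
  have ax: "axis i s = s *\<^sub>R axis i (1::real)" for s
    by (simp add: vec_eq_iff axis_def)
  obtain D where D: "(F has_derivative D) (at (x + axis i t))"
    using assms by (auto simp: differentiable_def)
  have "((\<lambda>t. x + t *\<^sub>R axis i 1) has_derivative (\<lambda>h. h *\<^sub>R axis i 1)) (at t)"
    by (auto intro!: derivative_eq_intros)
  then have "((\<lambda>t. x + axis i t) has_derivative (\<lambda>h. axis i h)) (at t)"
    by (simp only: ax[symmetric])
  from has_derivative_compose[OF this D]
  have "((\<lambda>t. F (x + axis i t)) has_derivative (\<lambda>h. D (axis i h))) (at t)" .
  moreover have "(\<lambda>h. D (axis i h)) = (*) (D (axis i 1))"
    using linear_scale[OF has_derivative_linear[OF D], of _ "axis i 1"]
    by (intro ext) (metis ax mult.commute real_scaleR_def)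
  ultimately show ?thesis
    by (simp only: has_field_derivative_def partial_deriv_eqI[OF D])
qed

text \<open>Translation invariance makes the integrals of all difference quotients vanish; they converge
  boundedly to the partial derivative.\<close>

lemma integral_partial_deriv_eq_0:
  fixes F :: "real^'n \<Rightarrow> real"
  assumes diff: "\<And>x. F differentiable (at x)" and cont: "continuous_on UNIV (partial_deriv i F)"
    and K: "compact K" "\<And>x. x \<notin> K \<Longrightarrow> F x = 0"
  shows "integral\<^sup>L lborel (partial_deriv i F) = 0"
proof -
  have PK: "partial_deriv i F x = 0" if "x \<notin> K" for x
    using partial_deriv_outside_support[of K F x i] K that compact_imp_closed by blast
  obtain B where B: "\<And>x. \<bar>partial_deriv i F x\<bar> \<le> B" "0 \<le> B"
    using continuous_compact_support_bounded[OF cont K(1) PK] by blast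
  obtain r where r: "\<And>x. x \<in> K \<Longrightarrow> norm x \<le> r"
    using compact_imp_bounded[OF K(1)] by (auto simp: bounded_iff)
  have contF: "continuous_on UNIV F"
    using diff by (simp add: continuous_at_imp_continuous_on differentiable_imp_continuous_within)
  have intF: "integrable lborel F"
    by (rule integrable_continuous_compact_support[OF contF K])
  note DF = has_real_derivative_along_axis[OF diff]
  have ax0: "axis i 0 = (0 :: real^'n)"
    by (simp add: vec_eq_iff axis_def)
  have DF0: "((\<lambda>t. F (x + axis i t)) has_real_derivative partial_deriv i F x) (at 0)" for x
    using has_real_derivative_along_axis[OF diff, of x i 0] unfolding ax0 add_0_right .
  \<comment> \<open>Difference quotients with step 1/(n+1). Starting from \<open>Suc n\<close>
    avoids division by zero and keeps all steps at most 1, so that one ball of radius r + 1 serves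
    for every n.\<close>
  define s where "s n x = real (Suc n) * (F (x + axis i (1 / real (Suc n))) - F x)" for n x
  have bound: "\<bar>s n x\<bar> \<le> B * indicator (cball 0 (r + 1)) x" for n x
  proof (cases "norm x \<le> r + 1")
    case True
    \<comment> \<open>By the mean value theorem the quotient is a value of the partial derivative,
      and so is bounded by B.\<close>
    obtain z where z: "F (x + axis i (1 / real (Suc n))) - F (x + axis i 0)
        = (1 / real (Suc n) - 0) * partial_deriv i F (x + axis i z)"
      using MVT2[of 0 "1 / real (Suc n)" "\<lambda>t. F (x + axis i t)"
          "\<lambda>t. partial_deriv i F (x + axis i t)"] DF by auto
    then have "s n x = partial_deriv i F (x + axis i z)"
      by (simp add: s_def ax0)
    then show ?thesis
      using B(1) True by simp
  next
    case False
    \<comment> \<open>Outside the larger ball both points of the quotient have norm above r and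
      hence lie off K, where F vanishes.\<close>
    have "norm (axis i (1 / real (Suc n)) :: real^'n) \<le> 1"
      by (simp add: norm_vec_def L2_set_def axis_def if_distrib[of "\<lambda>t. t\<^sup>2"] cong: if_cong)
    then have "norm (x + axis i (1 / real (Suc n))) > r" "norm x > r"
      using False norm_diff_ineq[of x "axis i (1 / real (Suc n))"] by auto
    then have "F x = 0" "F (x + axis i (1 / real (Suc n))) = 0"
      using r K(2) by (meson not_less)+
    then show ?thesis
      using B(2) by (simp add: s_def)
  qed
  have lim: "(\<lambda>n. s n x) \<longlonglongrightarrow> partial_deriv i F x" for x
  proof -
    have "((\<lambda>h. (F (x + axis i h) - F x) / h) \<longlongrightarrow> partial_deriv i F x) (at 0)"
      using DF0[of x] unfolding DERIV_def by (simp only: add_0_left ax0 add_0_right)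
    moreover have "filterlim (\<lambda>n. 1 / real (Suc n)) (at 0) sequentially"
      using LIMSEQ_Suc[OF lim_1_over_n] unfolding filterlim_at
      by (intro conjI always_eventually) simp_all
    ultimately have "(\<lambda>n. (F (x + axis i (1 / real (Suc n))) - F x) / (1 / real (Suc n)))
        \<longlonglongrightarrow> partial_deriv i F x"
      by (rule filterlim_compose)
    then show ?thesis
      by (simp add: s_def mult.commute)
  qed
  have shift: "integrable lborel (\<lambda>x. F (x + c))" "integral\<^sup>L lborel (\<lambda>x. F (x + c)) = integral\<^sup>L lborel F" for c
  proof -
    have m: "F \<in> borel_measurable borel"
      by (rule borel_measurable_continuous_onI[OF contF])
    show "integrable lborel (\<lambda>x. F (x + c))"
      using integrable_distr_eq[of "(+) c" lborel borel F] m intF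
      by (simp add: lborel_distr_plus add.commute)
    show "integral\<^sup>L lborel (\<lambda>x. F (x + c)) = integral\<^sup>L lborel F"
      using integral_distr[of "(+) c" lborel borel F] m
      by (simp add: lborel_distr_plus add.commute)
  qed
  have int_s: "integrable lborel (s n)" for n
    unfolding s_def using shift(1) intF by simp
  have fin: "integrable lborel (\<lambda>x. B * indicator (cball 0 (r + 1)) x :: real)"
    using emeasure_bounded_finite[OF bounded_cball]
    by (intro integrable_mult_right integrable_real_indicator) (simp_all add: less_top)
  have "integral\<^sup>L lborel (s n) = 0" for n
    unfolding s_def using shift intF by (simp del: of_nat_Suc)
  moreover have "(\<lambda>n. integral\<^sup>L lborel (s n)) \<longlonglongrightarrow> integral\<^sup>L lborel (partial_deriv i F)"
  proof (rule integral_dominated_convergence[where w="\<lambda>x. B * indicator (cball 0 (r + 1)) x"])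
    show "s n \<in> borel_measurable lborel" for n
      by (rule borel_measurable_integrable[OF int_s])
    show "partial_deriv i F \<in> borel_measurable lborel"
      using borel_measurable_continuous_onI[OF cont] by simp
  qed (use bound lim fin in \<open>auto simp del: integrable_mult_right_iff\<close>)
  ultimately show ?thesis
    by (simp add: LIMSEQ_const_iff)
qed

section \<open>Test functions and local integrability\<close>

lemma test_functionsD:
  assumes "\<phi> \<in> test_functions \<Omega>"
  shows "\<And>x. \<phi> differentiable (at x)" "continuous_on UNIV \<phi>"
    "partial_deriv i \<phi> \<in> test_functions \<Omega>"
    "compact (closure {x. \<phi> x \<noteq> 0})" "closure {x. \<phi> x \<noteq> 0} \<subseteq> \<Omega>"
    "\<And>x. x \<notin> closure {x. \<phi> x \<noteq> 0} \<Longrightarrow> \<phi> x = 0"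
proof -
  let ?K = "closure {x. \<phi> x \<noteq> 0}"
  have C: "Ck_on k UNIV \<phi>" for k
    using assms by (simp add: test_functions_def)
  show "\<phi> differentiable (at x)" "continuous_on UNIV \<phi>" for x
    using C[of 1] C[of 0] by auto
  show K: "compact ?K" "?K \<subseteq> \<Omega>"
    using assms by (auto simp: test_functions_def)
  show 0: "x \<notin> ?K \<Longrightarrow> \<phi> x = 0" for x
    using closure_subset[of "{x. \<phi> x \<noteq> 0}"] by auto
  have "closure {x. partial_deriv i \<phi> x \<noteq> 0} \<subseteq> ?K"
    using partial_deriv_outside_support[of ?K \<phi>, OF closed_closure 0] by (intro closure_minimal closed_closure) blast
  moreover from this have "compact (closure {x. partial_deriv i \<phi> x \<noteq> 0})"
    using K(1) by (meson bounded_subset closed_closure compact_eq_bounded_closed)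
  moreover have "Ck_on k UNIV (partial_deriv i \<phi>)" for k
    using C[of "Suc k"] by simp
  ultimately show "partial_deriv i \<phi> \<in> test_functions \<Omega>"
    using K(2) unfolding test_functions_def by blast
qed

text \<open>A common class for \<open>L2\<close> functions on open sets and for functions that are
  merely continuous inside \<Omega>, such as \<Delta>u. Cutting off by an indicator inside the full
  Lebesgue measure makes passing to a smaller set immediate.\<close>

definition loc_integrable :: "(real^'n) set \<Rightarrow> (real^'n \<Rightarrow> real) \<Rightarrow> bool" where
  "loc_integrable \<Omega> h \<longleftrightarrow> (\<forall>K. compact K \<and> K \<subseteq> \<Omega> \<longrightarrow> integrable lebesgue (\<lambda>x. indicator K x * h x))"

lemma loc_integrable_subset: "loc_integrable \<Omega> h \<Longrightarrow> S \<subseteq> \<Omega> \<Longrightarrow> loc_integrable S h"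
  by (auto simp: loc_integrable_def)

lemma loc_integrable_minus: "loc_integrable \<Omega> h \<Longrightarrow> loc_integrable \<Omega> (\<lambda>x. - h x)"
  by (auto simp: loc_integrable_def)

lemma loc_integrable_diff: "loc_integrable \<Omega> g \<Longrightarrow> loc_integrable \<Omega> h \<Longrightarrow> loc_integrable \<Omega> (\<lambda>x. g x - h x)"
  by (auto simp: loc_integrable_def right_diff_distrib)

lemma loc_integrable_continuous:
  assumes "continuous_on \<Omega> h"
  shows "loc_integrable \<Omega> h"
  unfolding loc_integrable_def
proof (intro allI impI)
  fix K assume "compact K \<and> K \<subseteq> \<Omega>"
  then have "integrable lborel (\<lambda>x. indicator K x *\<^sub>R h x)"
    using assms by (intro borel_integrable_compact) (auto intro: continuous_on_subset)
  then show "integrable lebesgue (\<lambda>x. indicator K x * h x)"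
    using integrable_completion[of "\<lambda>x. indicator K x *\<^sub>R h x" lborel] by (simp add: borel_measurable_integrable)
qed

text \<open>A compact set has finite measure, and \<bar>t\<bar> \<le> 1 + t^2 dominates h on it by
  an integrable function.\<close>

lemma loc_integrable_L2:
  assumes "h \<in> L2 \<Omega>" "open \<Omega>"
  shows "loc_integrable \<Omega> h"
  unfolding loc_integrable_def
proof (intro allI impI)
  fix K assume K: "compact K \<and> K \<subseteq> \<Omega>"
  have sets: "\<Omega> \<in> sets lebesgue" "K \<in> sets lebesgue"
    using assms K by (auto simp: compact_imp_closed)
  have fin: "emeasure lebesgue K < \<infinity>"
    using K emeasure_compact_finite[of K] by (simp add: compact_imp_closed)
  have int: "integrable lebesgue (\<lambda>x. indicator \<Omega> x *\<^sub>R (h x)\<^sup>2)"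
    and m: "(\<lambda>x. indicator \<Omega> x *\<^sub>R h x) \<in> borel_measurable lebesgue"
    using assms sets by (auto simp: L2_def integrable_restrict_space borel_measurable_restrict_space_iff)
  show "integrable lebesgue (\<lambda>x. indicator K x * h x)"
  proof (rule Bochner_Integration.integrable_bound)
    show "integrable lebesgue (\<lambda>x. indicator K x + indicator \<Omega> x *\<^sub>R (h x)\<^sup>2)"
      using int sets fin by (intro Bochner_Integration.integrable_add integrable_real_indicator) auto
    \<comment> \<open>Measurability of h is known only on \<Omega>; its zero extension is inserted
      first, which changes nothing since K \<subseteq> \<Omega>.\<close>
    have "(\<lambda>x. indicator K x * h x) = (\<lambda>x. indicator K x * (indicator \<Omega> x *\<^sub>R h x))"
      using K by (intro ext) (auto simp: indicator_def)
    also have "\<dots> \<in> borel_measurable lebesgue"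
      using m sets(2) by (rule borel_measurable_times[OF borel_measurable_indicator, rotated])
    finally show "(\<lambda>x. indicator K x * h x) \<in> borel_measurable lebesgue" .
    have "\<bar>t\<bar> \<le> 1 + t\<^sup>2" for t :: real
      using sum_squares_bound[of 1 "\<bar>t\<bar>"] by (simp add: power2_eq_square)
    then show "AE x in lebesgue. norm (indicator K x * h x) \<le> norm (indicator K x + indicator \<Omega> x *\<^sub>R (h x)\<^sup>2)"
      using K by (auto simp: indicator_def)
  qed
qed

lemma integrable_loc_mult:
  assumes h: "loc_integrable \<Omega> h" and "open \<Omega>"
    and c: "continuous_on UNIV \<theta>" and K: "compact K" "K \<subseteq> \<Omega>" "\<And>x. x \<notin> K \<Longrightarrow> \<theta> x = 0"
  shows "integrable (lebesgue_on \<Omega>) (\<lambda>x. h x * \<theta> x)"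
proof -
  obtain B where B: "\<And>x. \<bar>\<theta> x\<bar> \<le> B" "0 \<le> B"
    using continuous_compact_support_bounded[OF c K(1) K(3)] by blast
  have int: "integrable lebesgue (\<lambda>x. indicator K x * h x)"
    using h K by (auto simp: loc_integrable_def)
  have m: "\<theta> \<in> borel_measurable lebesgue"
    using borel_measurable_continuous_onI[OF c] by (simp add: measurable_completion)
  have eq: "indicator \<Omega> x * (h x * \<theta> x) = (indicator K x * h x) * \<theta> x" for x
    using K(2) K(3)[of x] by (auto simp: indicator_def)
  have "integrable lebesgue (\<lambda>x. (indicator K x * h x) * \<theta> x)"
  proof (rule Bochner_Integration.integrable_bound)
    show "integrable lebesgue (\<lambda>x. B * (indicator K x * h x))"
      using int by simp
    show "AE x in lebesgue. norm (indicator K x * h x * \<theta> x) \<le> norm (B * (indicator K x * h x))"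
      using B by (auto simp: abs_mult mult.commute[of B] intro!: mult_left_mono)
    show "(\<lambda>x. indicator K x * h x * \<theta> x) \<in> borel_measurable lebesgue"
      using int m by (simp add: borel_measurable_integrable)
  qed
  then show ?thesis
    using \<open>open \<Omega>\<close> by (simp add: integrable_restrict_space eq)
qed

lemma integrable_loc_mult_test:
  assumes "loc_integrable \<Omega> h" "open \<Omega>" "\<phi> \<in> test_functions \<Omega>"
  shows "integrable (lebesgue_on \<Omega>) (\<lambda>x. h x * \<phi> x)"
  by (rule integrable_loc_mult[OF assms(1,2) test_functionsD(2,4,5,6)[OF assms(3)]])

text \<open>The product of u and \<phi>, set to zero outside \<Omega>, is continuously
  differentiable in direction i everywhere: \<Omega> and the complement of the support of \<phi> are
  open and cover the space, and on the second set the product is 0. Its partial derivative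
  integrates to 0, and the product rule splits this integral.\<close>

lemma integral_by_parts_test:
  assumes "open \<Omega>" and diff: "\<And>x. x \<in> \<Omega> \<Longrightarrow> u differentiable (at x)"
    and cont: "continuous_on \<Omega> (partial_deriv i u)" and \<phi>: "\<phi> \<in> test_functions \<Omega>"
  shows "(LINT x|lebesgue_on \<Omega>. u x * partial_deriv i \<phi> x) = - (LINT x|lebesgue_on \<Omega>. partial_deriv i u x * \<phi> x)"
proof -
  note T = test_functionsD[OF \<phi>]
  note T' = test_functionsD[OF T(3)[of i]]
  define K where "K = closure {x. \<phi> x \<noteq> 0}"
  have K: "compact K" "closed K" "K \<subseteq> \<Omega>" "\<And>x. x \<notin> K \<Longrightarrow> \<phi> x = 0"
    unfolding K_def using T(4-6) closed_closure by blast+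
  define F where "F x = (if x \<in> \<Omega> then u x * \<phi> x else 0)" for x
  have FK: "F x = 0" if "x \<notin> K" for x
    using that K by (simp add: F_def)
  have inside: "F differentiable (at x)" "partial_deriv i F x = u x * partial_deriv i \<phi> x + partial_deriv i u x * \<phi> x"
    if "x \<in> \<Omega>" for x
  proof -
    have d: "(\<lambda>x. u x * \<phi> x) differentiable (at x)"
      using diff[OF that] T(1) by (intro differentiable_mult)
    show "F differentiable (at x)" "partial_deriv i F x = u x * partial_deriv i \<phi> x + partial_deriv i u x * \<phi> x"
      using partial_deriv_eq_on_open[of \<Omega> x "\<lambda>x. u x * \<phi> x" F] that assms(1) d
        partial_deriv_mult[OF diff[OF that] T(1)] by (auto simp: F_def)
  qed
  have outside: "F differentiable (at x)" "partial_deriv i F x = 0" if "x \<notin> K" for x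
    using partial_deriv_eq_on_open[of "- K" x "\<lambda>_. 0" F] FK that K(2) by auto
  have cu: "continuous_on \<Omega> u"
    using diff by (simp add: continuous_at_imp_continuous_on differentiable_imp_continuous_within)
  have "continuous_on (\<Omega> \<union> - K) (partial_deriv i F)"
  proof (rule continuous_on_open_Un)
    have "continuous_on \<Omega> (\<lambda>x. u x * partial_deriv i \<phi> x + partial_deriv i u x * \<phi> x)"
      using cu cont T(2) T'(2) by (intro continuous_intros) (auto intro: continuous_on_subset)
    then show "continuous_on \<Omega> (partial_deriv i F)"
      by (rule continuous_on_eq) (simp add: inside)
    show "continuous_on (- K) (partial_deriv i F)"
      by (rule continuous_on_eq[OF continuous_on_const[of _ 0]]) (simp add: outside)
  qed (use assms K in auto)
  moreover have "\<Omega> \<union> - K = UNIV"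
    using K by auto
  ultimately have cF: "continuous_on UNIV (partial_deriv i F)"
    by simp
  have dF: "F differentiable (at x)" for x
    using inside(1) outside(1) K(3) by blast
  have "0 = integral\<^sup>L lborel (partial_deriv i F)"
    using integral_partial_deriv_eq_0[OF dF cF K(1) FK] by simp
  also have "\<dots> = integral\<^sup>L lebesgue (partial_deriv i F)"
    using borel_measurable_continuous_onI[OF cF] by (simp add: integral_completion)
  also have "partial_deriv i F = (\<lambda>x. indicator \<Omega> x *\<^sub>R (u x * partial_deriv i \<phi> x + partial_deriv i u x * \<phi> x))"
    using inside(2) outside(2) K(3) by (fastforce simp: indicator_def)
  also have "integral\<^sup>L lebesgue \<dots> = (LINT x|lebesgue_on \<Omega>. u x * partial_deriv i \<phi> x + partial_deriv i u x * \<phi> x)"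
    using \<open>open \<Omega>\<close> by (simp add: integral_restrict_space)
  also have "\<dots> = (LINT x|lebesgue_on \<Omega>. u x * partial_deriv i \<phi> x) + (LINT x|lebesgue_on \<Omega>. partial_deriv i u x * \<phi> x)"
    using loc_integrable_continuous[OF cu] loc_integrable_continuous[OF cont] \<phi> T(3) \<open>open \<Omega>\<close>
    by (intro Bochner_Integration.integral_add integrable_loc_mult_test)
  finally show ?thesis
    by simp
qed

section \<open>The fundamental lemma of the calculus of variations\<close>

text \<open>Used to move between \<Omega> and the non-contact set, on which the test functions for
  the complementarity condition live.\<close>

lemma integral_test_restrict:
  assumes "open \<Omega>" "S \<subseteq> \<Omega>" "open S" "\<phi> \<in> test_functions S"
  shows "(LINT x|lebesgue_on \<Omega>. h x * \<phi> x) = (LINT x|lebesgue_on S. h x * \<phi> x)"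
proof -
  have "\<phi> x = 0" if "x \<notin> S" for x
    using test_functionsD(5,6)[OF assms(4)] that by blast
  then have "(\<lambda>x. indicator \<Omega> x *\<^sub>R (h x * \<phi> x)) = (\<lambda>x. indicator S x *\<^sub>R (h x * \<phi> x))"
    using assms(2) by (intro ext) (auto simp: indicator_def)
  then show ?thesis
    using assms by (simp add: integral_restrict_space)
qed

text \<open>The smooth bumps converge boundedly to the indicator of a box, so the hypothesis passes to
  integrals over boxes, and the Lebesgue differentiation theorem gives the pointwise inequality.\<close>

lemma AE_nonneg_if_test_integrals_nonneg:
  fixes h :: "real^'n \<Rightarrow> real"
  assumes "open S" and h: "loc_integrable S h"
    and test: "\<And>\<phi>. \<phi> \<in> test_functions S \<Longrightarrow> (\<And>x. 0 \<le> \<phi> x \<and> \<phi> x \<le> 1) \<Longrightarrow>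
                 0 \<le> (LINT x|lebesgue_on S. h x * \<phi> x)"
  shows "AE x in lebesgue_on S. 0 \<le> h x"
proof -
  have int: "integrable lebesgue (\<lambda>x. indicator (cbox a b) x * h x)" if "cbox a b \<subseteq> S" for a b
    using h that by (auto simp: loc_integrable_def)
  have box_nonneg: "0 \<le> integral (cbox c d) h" if cd: "cbox c d \<subseteq> S" for c d
  proof -
    have int_box: "integrable lebesgue (\<lambda>x. indicator (box c d) x * (indicator (cbox c d) x * h x))"
      using integrable_mult_indicator[OF _ int[OF cd], of "box c d"] by simp
    have eq_int: "(LINT x|lebesgue_on S. h x * box_bump n c d x)
        = (LINT x|lebesgue. box_bump n c d x * (indicator (cbox c d) x * h x))" for n
    proof -
      have "(\<lambda>x. indicator S x * (h x * box_bump n c d x))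
          = (\<lambda>x. box_bump n c d x * (indicator (cbox c d) x * h x))"
        using cd box_bump_eq_0[of _ c d n] box_subset_cbox[of c d]
        by (intro ext) (auto simp: indicator_def)
      then show ?thesis
        using \<open>open S\<close> by (simp add: integral_restrict_space)
    qed
    have "(\<lambda>n. LINT x|lebesgue. box_bump n c d x * (indicator (cbox c d) x * h x))
      \<longlonglongrightarrow> (LINT x|lebesgue. indicator (box c d) x * (indicator (cbox c d) x * h x))"
    proof (rule integral_dominated_convergence)
      show "integrable lebesgue (\<lambda>x. \<bar>indicator (cbox c d) x * h x\<bar>)"
        using int[OF cd] by (rule integrable_abs)
      show "(\<lambda>x. indicator (box c d) x * (indicator (cbox c d) x * h x)) \<in> borel_measurable lebesgue"
        using int_box by (rule borel_measurable_integrable)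
      have "box_bump n c d \<in> borel_measurable lebesgue" for n
        using borel_measurable_continuous_onI[of "box_bump n c d"] Ck_on_box_bump[of 0 n c d]
        by (simp add: measurable_completion)
      then show "(\<lambda>x. box_bump n c d x * (indicator (cbox c d) x * h x)) \<in> borel_measurable lebesgue" for n
        by (intro borel_measurable_times borel_measurable_integrable[OF int[OF cd]])
      show "AE x in lebesgue. (\<lambda>n. box_bump n c d x * (indicator (cbox c d) x * h x))
          \<longlonglongrightarrow> indicator (box c d) x * (indicator (cbox c d) x * h x)"
        by (intro AE_I2 tendsto_mult box_bump_tendsto_indicator tendsto_const)
      show "AE x in lebesgue. norm (box_bump n c d x * (indicator (cbox c d) x * h x))
          \<le> \<bar>indicator (cbox c d) x * h x\<bar>" for n
        using box_bump_bounds[of n c d] by (intro AE_I2) (simp add: abs_mult mult_left_le_one_le)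
    qed
    moreover have "0 \<le> (LINT x|lebesgue. box_bump n c d x * (indicator (cbox c d) x * h x))" for n
      using test[OF box_bump_test_function[OF cd]] box_bump_bounds[of n c d] by (simp flip: eq_int)
    ultimately have "0 \<le> (LINT x|lebesgue. indicator (box c d) x * (indicator (cbox c d) x * h x))"
      by (intro tendsto_lowerbound[where F=sequentially]) auto
    also have "(\<lambda>x. indicator (box c d) x * (indicator (cbox c d) x * h x)) = (\<lambda>x. indicator (box c d) x *\<^sub>R h x)"
      using box_subset_cbox[of c d] by (intro ext) (auto simp: indicator_def)
    also have "integral\<^sup>L lebesgue \<dots> = integral\<^sup>L (lebesgue_on (box c d)) h"
      by (simp add: integral_restrict_space)
    also have "\<dots> = integral (box c d) h"
    proof (rule lebesgue_integral_eq_integral)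
      have "(\<lambda>x. indicator (box c d) x * (indicator (cbox c d) x * h x)) = (\<lambda>x. indicator (box c d) x *\<^sub>R h x)"
        using box_subset_cbox[of c d] by (intro ext) (auto simp: indicator_def)
      then show "integrable (lebesgue_on (box c d)) h"
        using int_box by (simp add: integrable_restrict_space)
    qed simp
    also have "\<dots> = integral (cbox c d) h"
      by (rule integral_open_interval)
    finally show ?thesis .
  qed
  have neg: "negligible {x \<in> cbox a b. h x < 0}" if ab: "cbox a b \<subseteq> S" for a b
  proof -
    \<comment> \<open>Only locally integrable on S, h is cut off to a closed box to obtain a
      function integrable on the whole space, to which Lebesgue differentiation applies.\<close>
    define H where "H x = indicator (cbox a b) x * h x" for x
    have "H integrable_on UNIV"
      using int[OF ab] integrable_on_lebesgue unfolding H_def by blast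
    then have "H integrable_on cbox c d" for c d
      by (rule integrable_on_subcbox) simp
    then obtain N where N: "negligible N"
      "\<And>x e. x \<notin> N \<Longrightarrow> 0 < e \<Longrightarrow> \<exists>d>0. \<forall>t. 0 < t \<and> t < d \<longrightarrow>
         norm (integral (cbox x (x + t *\<^sub>R One)) H /\<^sub>R t ^ DIM(real^'n) - H x) < e"
      using integrable_ccontinuous_explicit[of H] by metis
    have "0 \<le> h x" if x: "x \<in> box a b" "x \<notin> N" for x
    proof (rule ccontr)
      assume "\<not> 0 \<le> h x"
      \<comment> \<open>With tolerance - h x > 0, the averages over small cubes with lower corner x
        are strictly negative, against \<open>box_nonneg\<close>.\<close>
      then obtain d where d: "d > 0" "\<And>t. 0 < t \<Longrightarrow> t < d \<Longrightarrow>
         norm (integral (cbox x (x + t *\<^sub>R One)) H /\<^sub>R t ^ DIM(real^'n) - H x) < - h x"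
        using N(2)[OF x(2), of "- h x"] by auto
      obtain r where r: "r > 0" "cball x r \<subseteq> box a b"
        using x(1) open_contains_cball open_box by blast
      \<comment> \<open>The half makes t strictly smaller than d; the second bound keeps the
        diagonal of the cube within r, so the cube stays in the box.\<close>
      define t where "t = min (d / 2) (r / norm (One :: real^'n))"
      have t: "0 < t" "t < d" "t * norm (One :: real^'n) \<le> r"
        using d(1) r(1) by (auto simp: t_def min_def field_simps)
      have "cbox x (x + t *\<^sub>R One) \<subseteq> cball x r"
      proof
        fix y assume y: "y \<in> cbox x (x + t *\<^sub>R One)"
        have "norm (y - x) \<le> norm (t *\<^sub>R One :: real^'n)"
          using y by (intro norm_le_componentwise) (auto simp: mem_box inner_diff_left inner_add_left)
        then show "y \<in> cball x r"
          using t by (simp add: dist_norm norm_minus_commute)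
      qed
      then have sub: "cbox x (x + t *\<^sub>R One) \<subseteq> cbox a b"
        using r(2) box_subset_cbox by blast
      then have "integral (cbox x (x + t *\<^sub>R One)) H = integral (cbox x (x + t *\<^sub>R One)) h"
        by (intro integral_cong) (auto simp: H_def)
      then have "0 \<le> integral (cbox x (x + t *\<^sub>R One)) H /\<^sub>R t ^ DIM(real^'n)"
        using box_nonneg[of x "x + t *\<^sub>R One"] sub ab t(1) by simp
      moreover have "H x = h x"
        using subsetD[OF box_subset_cbox x(1)] by (simp add: H_def)
      ultimately show False
        using d(2)[OF t(1,2)] by (simp add: abs_less_iff)
    qed
    then have "{x \<in> cbox a b. h x < 0} \<subseteq> N \<union> (cbox a b - box a b)"
      by force
    then show ?thesis
      using N(1) negligible_Un negligible_frontier_interval negligible_subset by blast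
  qed
  \<comment> \<open>An open set is a countable union of closed boxes, so the exceptional sets of the
    single boxes add up to a null set.\<close>
  obtain \<D> where \<D>: "countable \<D>" "\<D> \<subseteq> Pow S" "\<And>X. X \<in> \<D> \<Longrightarrow> \<exists>a b. X = cbox a b" "\<Union>\<D> = S"
    using open_countable_Union_open_cbox[OF \<open>open S\<close>] by metis
  have "negligible (\<Union>X\<in>\<D>. {x \<in> X. h x < 0})"
    using \<D> neg by (intro negligible_countable_Union) (auto, blast)
  moreover have "(\<Union>X\<in>\<D>. {x \<in> X. h x < 0}) = {x \<in> S. h x < 0}"
    using \<D>(4) by auto
  ultimately have "AE x in lebesgue. x \<notin> {x \<in> S. h x < 0}"
    by (intro AE_not_in) (simp add: negligible_iff_null_sets)
  then have "AE x in lebesgue. x \<in> S \<longrightarrow> 0 \<le> h x"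
    by eventually_elim auto
  then show ?thesis
    using \<open>open S\<close> by (simp add: AE_restrict_space_iff)
qed

lemma AE_eq_0_if_test_integrals_eq_0:
  assumes "open S" and h: "loc_integrable S h"
    and test: "\<And>\<phi>. \<phi> \<in> test_functions S \<Longrightarrow> (LINT x|lebesgue_on S. h x * \<phi> x) = 0"
  shows "AE x in lebesgue_on S. h x = 0"
proof -
  have "AE x in lebesgue_on S. 0 \<le> h x"
    using assms by (intro AE_nonneg_if_test_integrals_nonneg) auto
  moreover have "AE x in lebesgue_on S. 0 \<le> - h x"
    using assms by (intro AE_nonneg_if_test_integrals_nonneg loc_integrable_minus) auto
  ultimately show ?thesis
    by eventually_elim simp
qed

section \<open>Sobolev spaces and the admissible set\<close>

lemma L2_mult_integrable:
  assumes "u \<in> L2 \<Omega>" "v \<in> L2 \<Omega>"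
  shows "integrable (lebesgue_on \<Omega>) (\<lambda>x. u x * v x)"
proof (rule Bochner_Integration.integrable_bound)
  show "integrable (lebesgue_on \<Omega>) (\<lambda>x. (u x)\<^sup>2 + (v x)\<^sup>2)"
    using assms by (simp add: L2_def)
  show "(\<lambda>x. u x * v x) \<in> borel_measurable (lebesgue_on \<Omega>)"
    using assms by (auto simp: L2_def intro!: borel_measurable_times)
  have "\<bar>a * b\<bar> \<le> a\<^sup>2 + b\<^sup>2" for a b :: real
    using sum_squares_bound[of "\<bar>a\<bar>" "\<bar>b\<bar>"] mult_nonneg_nonneg[of "\<bar>a\<bar>" "\<bar>b\<bar>"]
    by (simp only: abs_mult power2_abs) linarith
  then show "AE x in lebesgue_on \<Omega>. norm (u x * v x) \<le> norm ((u x)\<^sup>2 + (v x)\<^sup>2)"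
    by simp
qed

lemma L2_lincomb:
  assumes "u \<in> L2 \<Omega>" "v \<in> L2 \<Omega>"
  shows "(\<lambda>x. a * u x + b * v x) \<in> L2 \<Omega>"
proof -
  have "integrable (lebesgue_on \<Omega>) (\<lambda>x. a\<^sup>2 * (u x * u x) + 2 * a * b * (u x * v x) + b\<^sup>2 * (v x * v x))"
    using assms by (intro Bochner_Integration.integrable_add integrable_mult_right L2_mult_integrable)
  moreover have "(\<lambda>x. a\<^sup>2 * (u x * u x) + 2 * a * b * (u x * v x) + b\<^sup>2 * (v x * v x))
      = (\<lambda>x. (a * u x + b * v x)\<^sup>2)"
    by (simp add: fun_eq_iff power2_eq_square algebra_simps)
  moreover have "(\<lambda>x. a * u x + b * v x) \<in> borel_measurable (lebesgue_on \<Omega>)"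
    using assms by (auto simp: L2_def)
  ultimately show ?thesis
    by (simp add: L2_def)
qed

lemma test_functions_lincomb:
  assumes "\<phi> \<in> test_functions \<Omega>" "\<theta> \<in> test_functions \<Omega>"
  shows "(\<lambda>x. a * \<phi> x + b * \<theta> x) \<in> test_functions \<Omega>"
proof -
  let ?K = "closure {x. \<phi> x \<noteq> 0} \<union> closure {x. \<theta> x \<noteq> 0}"
  have K: "compact ?K" "?K \<subseteq> \<Omega>"
    using assms by (auto simp: test_functions_def)
  have "{x. a * \<phi> x + b * \<theta> x \<noteq> 0} \<subseteq> {x. \<phi> x \<noteq> 0} \<union> {x. \<theta> x \<noteq> 0}"
    by auto
  from closure_mono[OF this] have sub: "closure {x. a * \<phi> x + b * \<theta> x \<noteq> 0} \<subseteq> ?K"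
    by (simp only: closure_Un)
  then have "compact (closure {x. a * \<phi> x + b * \<theta> x \<noteq> 0})"
    using K(1) by (meson bounded_subset closed_closure compact_eq_bounded_closed)
  moreover have "Ck_on k UNIV (\<lambda>x. a * \<phi> x + b * \<theta> x)" for k
    using assms by (intro Ck_on_add Ck_on_mult Ck_on_const) (auto simp: test_functions_def)
  ultimately show ?thesis
    using sub K(2) by (auto simp: test_functions_def)
qed

lemma test_functions_L2:
  assumes "open \<Omega>" "\<phi> \<in> test_functions \<Omega>"
  shows "\<phi> \<in> L2 \<Omega>"
proof -
  have c: "continuous_on \<Omega> \<phi>"
    using test_functionsD(2)[OF assms(2)] by (rule continuous_on_subset) simp
  have "integrable (lebesgue_on \<Omega>) (\<lambda>x. \<phi> x * \<phi> x)"
    using assms by (intro integrable_loc_mult_test loc_integrable_continuous c)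
  then show ?thesis
    using continuous_imp_measurable_on_sets_lebesgue[OF c] assms(1) by (simp add: L2_def power2_eq_square)
qed

text \<open>Membership in \<open>L2\<close> makes every product with a test function integrable;
  without integrability the integral takes a default value and need not be additive.\<close>

lemma has_weak_partial_lincomb:
  assumes "open \<Omega>" and L2: "u \<in> L2 \<Omega>" "v \<in> L2 \<Omega>" "g \<in> L2 \<Omega>" "h \<in> L2 \<Omega>"
    and w: "has_weak_partial \<Omega> i u g" "has_weak_partial \<Omega> i v h"
  shows "has_weak_partial \<Omega> i (\<lambda>x. a * u x + b * v x) (\<lambda>x. a * g x + b * h x)"
  unfolding has_weak_partial_def
proof
  fix \<phi> assume \<phi>: "\<phi> \<in> test_functions \<Omega>"
  have test: "(LINT x|lebesgue_on \<Omega>. (a * p x + b * q x) * \<theta> x)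
      = a * (LINT x|lebesgue_on \<Omega>. p x * \<theta> x) + b * (LINT x|lebesgue_on \<Omega>. q x * \<theta> x)"
    if "p \<in> L2 \<Omega>" "q \<in> L2 \<Omega>" "\<theta> \<in> test_functions \<Omega>" for p q \<theta>
  proof -
    have "integrable (lebesgue_on \<Omega>) (\<lambda>x. p x * \<theta> x)" "integrable (lebesgue_on \<Omega>) (\<lambda>x. q x * \<theta> x)"
      using that test_functions_L2[OF assms(1)] by (auto intro: L2_mult_integrable)
    then show ?thesis
      by (simp add: distrib_right mult.assoc)
  qed
  show "(LINT x|lebesgue_on \<Omega>. (a * u x + b * v x) * partial_deriv i \<phi> x)
      = - (LINT x|lebesgue_on \<Omega>. (a * g x + b * h x) * \<phi> x)"
    using w \<phi> test[OF L2(1,2) test_functionsD(3)[OF \<phi>]] test[OF L2(3,4) \<phi>]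
    by (simp add: has_weak_partial_def)
qed

lemma weak_partial_H1:
  assumes "u \<in> H1 \<Omega>"
  shows "weak_partial \<Omega> i u \<in> L2 \<Omega>" "has_weak_partial \<Omega> i u (weak_partial \<Omega> i u)"
proof -
  have "\<exists>g. g \<in> L2 \<Omega> \<and> has_weak_partial \<Omega> i u g"
    using assms by (auto simp: H1_def)
  then show "weak_partial \<Omega> i u \<in> L2 \<Omega>" "has_weak_partial \<Omega> i u (weak_partial \<Omega> i u)"
    unfolding weak_partial_def by (rule someI2_ex, simp)+
qed

lemma H1_L2: "u \<in> H1 \<Omega> \<Longrightarrow> u \<in> L2 \<Omega>"
  by (simp add: H1_def)

text \<open>Two weak derivatives have the same integrals against all test functions, so the
  fundamental lemma applies to their difference. This is how the representative picked by choice is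
  computed.\<close>

lemma weak_partial_AE_eq:
  assumes "open \<Omega>" "u \<in> H1 \<Omega>" "g \<in> L2 \<Omega>" "has_weak_partial \<Omega> i u g"
  shows "AE x in lebesgue_on \<Omega>. weak_partial \<Omega> i u x = g x"
proof -
  note w = weak_partial_H1[OF assms(2), of i]
  have "AE x in lebesgue_on \<Omega>. weak_partial \<Omega> i u x - g x = 0"
  proof (rule AE_eq_0_if_test_integrals_eq_0[OF assms(1)])
    show "loc_integrable \<Omega> (\<lambda>x. weak_partial \<Omega> i u x - g x)"
      using assms w by (intro loc_integrable_diff loc_integrable_L2)
    fix \<phi> assume \<phi>: "\<phi> \<in> test_functions \<Omega>"
    have "integrable (lebesgue_on \<Omega>) (\<lambda>x. weak_partial \<Omega> i u x * \<phi> x)" "integrable (lebesgue_on \<Omega>) (\<lambda>x. g x * \<phi> x)"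
      using \<phi> assms w by (auto intro: L2_mult_integrable test_functions_L2)
    then show "(LINT x|lebesgue_on \<Omega>. (weak_partial \<Omega> i u x - g x) * \<phi> x) = 0"
      using w(2) assms(4) \<phi> by (simp add: left_diff_distrib has_weak_partial_def)
  qed
  then show ?thesis
    by simp
qed

lemma H1_lincomb:
  assumes "open \<Omega>" "u \<in> H1 \<Omega>" "v \<in> H1 \<Omega>"
  shows "(\<lambda>x. a * u x + b * v x) \<in> H1 \<Omega>"
  unfolding H1_def
  using L2_lincomb[OF H1_L2[OF assms(2)] H1_L2[OF assms(3)]]
    L2_lincomb[OF weak_partial_H1(1)[OF assms(2)] weak_partial_H1(1)[OF assms(3)]]
    has_weak_partial_lincomb[OF assms(1) H1_L2[OF assms(2)] H1_L2[OF assms(3)] weak_partial_H1(1)[OF assms(2)]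
      weak_partial_H1(1)[OF assms(3)] weak_partial_H1(2)[OF assms(2)] weak_partial_H1(2)[OF assms(3)]]
  by blast

text \<open>The choices made for u, v and their combination are unrelated, so linearity survives
  only almost everywhere; the null sets of the finitely many components are united.\<close>

lemma weak_grad_lincomb:
  assumes "open \<Omega>" "u \<in> H1 \<Omega>" "v \<in> H1 \<Omega>"
  shows "AE x in lebesgue_on \<Omega>. weak_grad \<Omega> (\<lambda>x. a * u x + b * v x) x
           = a *\<^sub>R weak_grad \<Omega> u x + b *\<^sub>R weak_grad \<Omega> v x"
proof -
  have "AE x in lebesgue_on \<Omega>. weak_partial \<Omega> i (\<lambda>x. a * u x + b * v x) x
      = a * weak_partial \<Omega> i u x + b * weak_partial \<Omega> i v x" for i
    using assms weak_partial_H1[OF assms(2)] weak_partial_H1[OF assms(3)] H1_L2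
    by (intro weak_partial_AE_eq H1_lincomb L2_lincomb has_weak_partial_lincomb) auto
  then have "AE x in lebesgue_on \<Omega>. \<forall>i. weak_partial \<Omega> i (\<lambda>x. a * u x + b * v x) x
      = a * weak_partial \<Omega> i u x + b * weak_partial \<Omega> i v x"
    by (simp add: AE_all_countable)
  then show ?thesis
    by eventually_elim (simp add: weak_grad_def vec_eq_iff)
qed

lemma integrable_weak_grad_inner:
  assumes "u \<in> H1 \<Omega>" "v \<in> H1 \<Omega>"
  shows "integrable (lebesgue_on \<Omega>) (\<lambda>x. weak_grad \<Omega> u x \<bullet> weak_grad \<Omega> v x)"
  using assms by (simp add: weak_grad_def inner_vec_def L2_mult_integrable weak_partial_H1)

lemma integrable_weak_grad_norm:
  assumes "u \<in> H1 \<Omega>"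
  shows "integrable (lebesgue_on \<Omega>) (\<lambda>x. (norm (weak_grad \<Omega> u x))\<^sup>2)"
  using integrable_weak_grad_inner[OF assms assms] by (simp add: power2_norm_eq_inner)

section \<open>The H1 norm and the closure of the test functions\<close>

lemma integrable_H1_norm:
  assumes "u \<in> H1 \<Omega>"
  shows "integrable (lebesgue_on \<Omega>) (\<lambda>x. (u x)\<^sup>2 + (norm (weak_grad \<Omega> u x))\<^sup>2)"
  using integrable_weak_grad_norm[OF assms] H1_L2[OF assms] by (simp add: L2_def)

lemma H1_norm_nonneg: "0 \<le> H1_norm \<Omega> u"
  by (simp add: H1_norm_def)

lemma H1_norm_square: "(H1_norm \<Omega> u)\<^sup>2 = (LINT x|lebesgue_on \<Omega>. (u x)\<^sup>2 + (norm (weak_grad \<Omega> u x))\<^sup>2)"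
  by (simp add: H1_norm_def)

text \<open>The parallelogram identity with the square of the difference dropped.\<close>

lemma norm_lincomb_square_le:
  fixes x y :: "'a::real_inner"
  shows "(norm (a *\<^sub>R x + b *\<^sub>R y))\<^sup>2 \<le> 2 * a\<^sup>2 * (norm x)\<^sup>2 + 2 * b\<^sup>2 * (norm y)\<^sup>2"
proof -
  have "(norm (p + q))\<^sup>2 + (norm (p - q))\<^sup>2 = 2 * (norm p)\<^sup>2 + 2 * (norm q)\<^sup>2" for p q :: 'a
    by (simp add: power2_norm_eq_inner inner_add_left inner_add_right inner_diff_left inner_diff_right
        inner_commute)
  from this[of "a *\<^sub>R x" "b *\<^sub>R y"] show ?thesis
    by (simp add: power_mult_distrib mult.assoc) (smt (verit) zero_le_power2)
qed

text \<open>A substitute for the triangle inequality that follows by integrating a pointwise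
  estimate. The lost factor 2 is harmless, since it is only used to show that norms vanish or tend
  to 0.\<close>

lemma H1_norm_lincomb:
  assumes "open \<Omega>" "u \<in> H1 \<Omega>" "v \<in> H1 \<Omega>"
  shows "(H1_norm \<Omega> (\<lambda>x. a * u x + b * v x))\<^sup>2 \<le> 2 * a\<^sup>2 * (H1_norm \<Omega> u)\<^sup>2 + 2 * b\<^sup>2 * (H1_norm \<Omega> v)\<^sup>2"
proof -
  note int = integrable_H1_norm[OF assms(2)] integrable_H1_norm[OF assms(3)]
  have "(H1_norm \<Omega> (\<lambda>x. a * u x + b * v x))\<^sup>2 \<le>
    (LINT x|lebesgue_on \<Omega>. 2 * a\<^sup>2 * ((u x)\<^sup>2 + (norm (weak_grad \<Omega> u x))\<^sup>2)
        + 2 * b\<^sup>2 * ((v x)\<^sup>2 + (norm (weak_grad \<Omega> v x))\<^sup>2))"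
    unfolding H1_norm_square
  proof (rule integral_mono_AE)
    show "integrable (lebesgue_on \<Omega>) (\<lambda>x. (a * u x + b * v x)\<^sup>2
        + (norm (weak_grad \<Omega> (\<lambda>x. a * u x + b * v x) x))\<^sup>2)"
      by (intro integrable_H1_norm H1_lincomb assms)
    show "integrable (lebesgue_on \<Omega>) (\<lambda>x. 2 * a\<^sup>2 * ((u x)\<^sup>2 + (norm (weak_grad \<Omega> u x))\<^sup>2)
        + 2 * b\<^sup>2 * ((v x)\<^sup>2 + (norm (weak_grad \<Omega> v x))\<^sup>2))"
      by (intro Bochner_Integration.integrable_add integrable_mult_right int)
    show "AE x in lebesgue_on \<Omega>. (a * u x + b * v x)\<^sup>2 + (norm (weak_grad \<Omega> (\<lambda>x. a * u x + b * v x) x))\<^sup>2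
      \<le> 2 * a\<^sup>2 * ((u x)\<^sup>2 + (norm (weak_grad \<Omega> u x))\<^sup>2) + 2 * b\<^sup>2 * ((v x)\<^sup>2 + (norm (weak_grad \<Omega> v x))\<^sup>2)"
      using weak_grad_lincomb[OF assms, of a b]
    proof eventually_elim
      case (elim x)
      show ?case
        using norm_lincomb_square_le[of a "weak_grad \<Omega> u x" b "weak_grad \<Omega> v x"]
          norm_lincomb_square_le[of a "u x" b "v x"]
        by (simp add: elim distrib_left)
    qed
  qed
  also have "\<dots> = 2 * a\<^sup>2 * (H1_norm \<Omega> u)\<^sup>2 + 2 * b\<^sup>2 * (H1_norm \<Omega> v)\<^sup>2"
    unfolding H1_norm_square
    by (subst Bochner_Integration.integral_add) (use int in \<open>auto intro: integrable_mult_right simp del: Bochner_Integration.integral_add\<close>)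
  finally show ?thesis .
qed

lemma has_weak_partial_test_function:
  assumes "open \<Omega>" "\<phi> \<in> test_functions \<Omega>"
  shows "has_weak_partial \<Omega> i \<phi> (partial_deriv i \<phi>)"
  unfolding has_weak_partial_def
  using integral_by_parts_test[OF assms(1), of \<phi> i] test_functionsD(1)[OF assms(2)]
    continuous_on_subset[OF test_functionsD(2)[OF test_functionsD(3)[OF assms(2)]], of \<Omega>]
  by blast

lemma test_functions_H1:
  assumes "open \<Omega>" "\<phi> \<in> test_functions \<Omega>"
  shows "\<phi> \<in> H1 \<Omega>"
  unfolding H1_def using has_weak_partial_test_function[OF assms] test_functions_L2[OF assms(1)]
    assms(2) test_functionsD(3)[OF assms(2)] by blast

lemma H1_0I:
  assumes "v \<in> H1 \<Omega>" "\<And>n. \<phi> n \<in> test_functions \<Omega>"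
    and "(\<lambda>n. H1_norm \<Omega> (\<lambda>x. v x - \<phi> n x)) \<longlonglongrightarrow> 0"
  shows "v \<in> H1_0 \<Omega>"
  using assms by (auto simp: H1_0_def)

lemma test_functions_H1_0:
  assumes "open \<Omega>" "\<phi> \<in> test_functions \<Omega>"
  shows "\<phi> \<in> H1_0 \<Omega>"
proof -
  note \<phi> = test_functions_H1[OF assms]
  \<comment> \<open>Even the gradient of the zero function is a chosen representative. The estimate
    with both coefficients 0 gives the norm without inspecting it.\<close>
  have "H1_norm \<Omega> (\<lambda>x. 0) = 0"
    using H1_norm_lincomb[OF assms(1) \<phi> \<phi>, of 0 0] by simp
  then show ?thesis
    using \<phi> assms(2) by (intro H1_0I[where \<phi>="\<lambda>_. \<phi>"]) simp_all
qed

lemma H1_0_lincomb: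
  assumes "open \<Omega>" "p \<in> H1_0 \<Omega>" "q \<in> H1_0 \<Omega>"
  shows "(\<lambda>x. a * p x + b * q x) \<in> H1_0 \<Omega>"
proof -
  obtain \<phi> where \<phi>: "\<And>n. \<phi> n \<in> test_functions \<Omega>" "(\<lambda>n. H1_norm \<Omega> (\<lambda>x. p x - \<phi> n x)) \<longlonglongrightarrow> 0"
    using assms(2) by (auto simp: H1_0_def)
  obtain \<theta> where \<theta>: "\<And>n. \<theta> n \<in> test_functions \<Omega>" "(\<lambda>n. H1_norm \<Omega> (\<lambda>x. q x - \<theta> n x)) \<longlonglongrightarrow> 0"
    using assms(3) by (auto simp: H1_0_def)
  have H1: "p \<in> H1 \<Omega>" "q \<in> H1 \<Omega>"
    using assms by (auto simp: H1_0_def)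
  define P where "P n = H1_norm \<Omega> (\<lambda>x. p x - \<phi> n x)" for n
  define Q where "Q n = H1_norm \<Omega> (\<lambda>x. q x - \<theta> n x)" for n
  define R where "R n = H1_norm \<Omega> (\<lambda>x. (a * p x + b * q x) - (a * \<phi> n x + b * \<theta> n x))" for n
  have "(R n)\<^sup>2 \<le> 2 * a\<^sup>2 * (P n)\<^sup>2 + 2 * b\<^sup>2 * (Q n)\<^sup>2" for n
  proof -
    have "(\<lambda>x. p x - \<phi> n x) \<in> H1 \<Omega>" "(\<lambda>x. q x - \<theta> n x) \<in> H1 \<Omega>"
      using H1_lincomb[OF assms(1) H1(1) test_functions_H1[OF assms(1) \<phi>(1)], of 1 "-1" n]
        H1_lincomb[OF assms(1) H1(2) test_functions_H1[OF assms(1) \<theta>(1)], of 1 "-1" n] by simp_all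
    from H1_norm_lincomb[OF assms(1) this, of a b] show ?thesis
      by (simp add: R_def P_def Q_def algebra_simps)
  qed
  then have "R n \<le> sqrt (2 * a\<^sup>2 * (P n)\<^sup>2 + 2 * b\<^sup>2 * (Q n)\<^sup>2)" for n
    by (rule real_le_rsqrt)
  moreover have "(\<lambda>n. sqrt (2 * a\<^sup>2 * (P n)\<^sup>2 + 2 * b\<^sup>2 * (Q n)\<^sup>2)) \<longlonglongrightarrow> sqrt (2 * a\<^sup>2 * 0\<^sup>2 + 2 * b\<^sup>2 * 0\<^sup>2)"
    using \<phi>(2) \<theta>(2) unfolding P_def Q_def by (intro tendsto_intros)
  ultimately have "R \<longlonglongrightarrow> 0"
    by (intro tendsto_sandwich[OF _ _ tendsto_const[of 0], of R sequentially]) (auto simp: R_def H1_norm_nonneg)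
  then show ?thesis
    using H1_lincomb[OF assms(1) H1] test_functions_lincomb[OF \<phi>(1) \<theta>(1)]
    by (intro H1_0I[where \<phi>="\<lambda>n x. a * \<phi> n x + b * \<theta> n x"]) (simp_all add: R_def[abs_def])
qed

section \<open>Convexity and perturbations of the admissible set\<close>

text \<open>Each of u and v comes with its own continuous function carrying the boundary values. The
  same convex combination of these two still equals g on the boundary, because the coefficients add
  up to 1.\<close>

lemma admissible_convex:
  assumes "open \<Omega>" "u \<in> admissible \<Omega> g \<psi>" "v \<in> admissible \<Omega> g \<psi>" and t: "0 \<le> t" "t \<le> 1"
  shows "(\<lambda>x. (1 - t) * u x + t * v x) \<in> admissible \<Omega> g \<psi>"
proof -
  have H1: "u \<in> H1 \<Omega>" "v \<in> H1 \<Omega>"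
    using assms by (auto simp: admissible_def dirichlet_class_def)
  obtain p where p: "p \<in> H1 \<Omega>" "continuous_on (closure \<Omega>) p" "\<forall>x\<in>frontier \<Omega>. p x = g x"
      "(\<lambda>x. u x - p x) \<in> H1_0 \<Omega>"
    using assms(2) by (auto simp: admissible_def dirichlet_class_def has_boundary_values_def)
  obtain q where q: "q \<in> H1 \<Omega>" "continuous_on (closure \<Omega>) q" "\<forall>x\<in>frontier \<Omega>. q x = g x"
      "(\<lambda>x. v x - q x) \<in> H1_0 \<Omega>"
    using assms(3) by (auto simp: admissible_def dirichlet_class_def has_boundary_values_def)
  define w where "w x = (1 - t) * p x + t * q x" for x
  have "(\<lambda>x. (1 - t) * u x + t * v x - w x) = (\<lambda>x. (1 - t) * (u x - p x) + t * (v x - q x))"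
    by (simp add: w_def fun_eq_iff algebra_simps)
  then have "(\<lambda>x. (1 - t) * u x + t * v x - w x) \<in> H1_0 \<Omega>"
    using H1_0_lincomb[OF assms(1) p(4) q(4)] by simp
  moreover have "w \<in> H1 \<Omega>"
    unfolding w_def by (intro H1_lincomb assms p q)
  moreover have "continuous_on (closure \<Omega>) w"
    unfolding w_def by (intro continuous_intros p q)
  moreover have "\<forall>x\<in>frontier \<Omega>. w x = g x"
    using p(3) q(3) by (simp add: w_def algebra_simps)
  ultimately have "has_boundary_values \<Omega> (\<lambda>x. (1 - t) * u x + t * v x) g"
    unfolding has_boundary_values_def by blast
  moreover have "AE x in lebesgue_on \<Omega>. \<psi> x \<le> u x" "AE x in lebesgue_on \<Omega>. \<psi> x \<le> v x"
    using assms by (auto simp: admissible_def)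
  then have "AE x in lebesgue_on \<Omega>. \<psi> x \<le> (1 - t) * u x + t * v x"
  proof eventually_elim
    case (elim x)
    have "\<psi> x = (1 - t) * \<psi> x + t * \<psi> x"
      by (simp add: algebra_simps)
    also have "\<dots> \<le> (1 - t) * u x + t * v x"
      using elim t by (intro add_mono mult_left_mono) auto
    finally show ?case .
  qed
  ultimately show ?thesis
    using H1_lincomb[OF assms(1) H1] by (simp add: admissible_def dirichlet_class_def)
qed

text \<open>The continuous function that carries the boundary values of u serves again, because
  \<phi> only changes the \<open>H1_0\<close> part.\<close>

lemma admissible_add_test_function:
  assumes "open \<Omega>" "u \<in> admissible \<Omega> g \<psi>" "\<phi> \<in> test_functions \<Omega>"
    and "AE x in lebesgue_on \<Omega>. \<psi> x \<le> u x + \<phi> x"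
  shows "(\<lambda>x. u x + \<phi> x) \<in> admissible \<Omega> g \<psi>"
proof -
  have H1: "u \<in> H1 \<Omega>"
    using assms by (auto simp: admissible_def dirichlet_class_def)
  obtain p where p: "p \<in> H1 \<Omega>" "continuous_on (closure \<Omega>) p" "\<forall>x\<in>frontier \<Omega>. p x = g x"
      "(\<lambda>x. u x - p x) \<in> H1_0 \<Omega>"
    using assms(2) by (auto simp: admissible_def dirichlet_class_def has_boundary_values_def)
  have "(\<lambda>x. u x + \<phi> x - p x) \<in> H1_0 \<Omega>"
    using H1_0_lincomb[OF assms(1) p(4) test_functions_H1_0[OF assms(1,3)], of 1 1]
    by (simp add: algebra_simps)
  then have "has_boundary_values \<Omega> (\<lambda>x. u x + \<phi> x) g"
    unfolding has_boundary_values_def using p by blast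
  then show ?thesis
    using assms(4) H1_lincomb[OF assms(1) H1 test_functions_H1[OF assms(1,3)], of 1 1]
    by (simp add: admissible_def dirichlet_class_def)
qed

section \<open>The obstacle problem\<close>

lemma energy_expansion:
  assumes "open \<Omega>" "f \<in> L2 \<Omega>" and H1: "u \<in> H1 \<Omega>" "d \<in> H1 \<Omega>"
  shows "energy \<Omega> f (\<lambda>x. u x + t * d x) = energy \<Omega> f u
    + t * ((LINT x|lebesgue_on \<Omega>. weak_grad \<Omega> u x \<bullet> weak_grad \<Omega> d x) - (LINT x|lebesgue_on \<Omega>. f x * d x))
    + t\<^sup>2 / 2 * (LINT x|lebesgue_on \<Omega>. (norm (weak_grad \<Omega> d x))\<^sup>2)"
proof -
  have int_energy: "integrable (lebesgue_on \<Omega>) (\<lambda>x. 1/2 * (norm (weak_grad \<Omega> v x))\<^sup>2 - f x * v x)"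
    if "v \<in> H1 \<Omega>" for v
    by (intro Bochner_Integration.integrable_diff integrable_mult_right
        integrable_weak_grad_norm[OF that] L2_mult_integrable[OF assms(2) H1_L2[OF that]])
  have int: "integrable (lebesgue_on \<Omega>) (\<lambda>x. weak_grad \<Omega> u x \<bullet> weak_grad \<Omega> d x)"
    "integrable (lebesgue_on \<Omega>) (\<lambda>x. f x * d x)"
    "integrable (lebesgue_on \<Omega>) (\<lambda>x. (norm (weak_grad \<Omega> d x))\<^sup>2)"
    using H1 assms(2) H1_L2 by (auto intro: integrable_weak_grad_inner integrable_weak_grad_norm L2_mult_integrable)
  have grad: "AE x in lebesgue_on \<Omega>. weak_grad \<Omega> (\<lambda>x. u x + t * d x) x = weak_grad \<Omega> u x + t *\<^sub>R weak_grad \<Omega> d x"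
    using weak_grad_lincomb[OF assms(1) H1, of 1 t] by simp
  have H1': "(\<lambda>x. u x + t * d x) \<in> H1 \<Omega>"
    using H1_lincomb[OF assms(1) H1, of 1 t] by simp
  have "energy \<Omega> f (\<lambda>x. u x + t * d x) = (LINT x|lebesgue_on \<Omega>.
      (1/2 * (norm (weak_grad \<Omega> u x))\<^sup>2 - f x * u x)
      + (t * (weak_grad \<Omega> u x \<bullet> weak_grad \<Omega> d x - f x * d x) + t\<^sup>2 / 2 * (norm (weak_grad \<Omega> d x))\<^sup>2))"
    unfolding energy_def
  proof (rule integral_cong_AE)
    show "(\<lambda>x. 1/2 * (norm (weak_grad \<Omega> (\<lambda>x. u x + t * d x) x))\<^sup>2 - f x * (u x + t * d x))
        \<in> borel_measurable (lebesgue_on \<Omega>)"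
      by (rule borel_measurable_integrable[OF int_energy[OF H1']])
    show "(\<lambda>x. (1/2 * (norm (weak_grad \<Omega> u x))\<^sup>2 - f x * u x)
      + (t * (weak_grad \<Omega> u x \<bullet> weak_grad \<Omega> d x - f x * d x) + t\<^sup>2 / 2 * (norm (weak_grad \<Omega> d x))\<^sup>2))
        \<in> borel_measurable (lebesgue_on \<Omega>)"
      by (intro borel_measurable_integrable Bochner_Integration.integrable_add
          Bochner_Integration.integrable_diff integrable_mult_right int_energy int H1)
    show "AE x in lebesgue_on \<Omega>. 1/2 * (norm (weak_grad \<Omega> (\<lambda>x. u x + t * d x) x))\<^sup>2 - f x * (u x + t * d x)
      = (1/2 * (norm (weak_grad \<Omega> u x))\<^sup>2 - f x * u x)
      + (t * (weak_grad \<Omega> u x \<bullet> weak_grad \<Omega> d x - f x * d x) + t\<^sup>2 / 2 * (norm (weak_grad \<Omega> d x))\<^sup>2)"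
      using grad
    proof eventually_elim
      case (elim x)
      have "(norm (weak_grad \<Omega> u x + t *\<^sub>R weak_grad \<Omega> d x))\<^sup>2 = (norm (weak_grad \<Omega> u x))\<^sup>2
          + 2 * t * (weak_grad \<Omega> u x \<bullet> weak_grad \<Omega> d x) + t\<^sup>2 * (norm (weak_grad \<Omega> d x))\<^sup>2"
        by (simp add: power2_norm_eq_inner inner_add_left inner_add_right inner_commute power2_eq_square[of t]
            algebra_simps)
      then show ?case
        by (simp add: elim algebra_simps)
    qed
  qed
  also have "\<dots> = energy \<Omega> f u
      + (t * ((LINT x|lebesgue_on \<Omega>. weak_grad \<Omega> u x \<bullet> weak_grad \<Omega> d x) - (LINT x|lebesgue_on \<Omega>. f x * d x))
        + t\<^sup>2 / 2 * (LINT x|lebesgue_on \<Omega>. (norm (weak_grad \<Omega> d x))\<^sup>2))"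
  proof -
    have i1: "integrable (lebesgue_on \<Omega>) (\<lambda>x. t * (weak_grad \<Omega> u x \<bullet> weak_grad \<Omega> d x - f x * d x))"
      and i2: "integrable (lebesgue_on \<Omega>) (\<lambda>x. t\<^sup>2 / 2 * (norm (weak_grad \<Omega> d x))\<^sup>2)"
      by (intro integrable_mult_right Bochner_Integration.integrable_diff int)+
    show ?thesis
      unfolding Bochner_Integration.integral_add[OF int_energy[OF H1(1)] Bochner_Integration.integrable_add[OF i1 i2]]
        Bochner_Integration.integral_add[OF i1 i2] integral_mult_right_zero
        Bochner_Integration.integral_diff[OF int(1,2)] energy_def ..
  qed
  finally show ?thesis
    by simp
qed

lemma energy_minimizer_iff_variational_solution:
  assumes "open \<Omega>" "f \<in> L2 \<Omega>" "u \<in> admissible \<Omega> g \<psi>"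
  shows "energy_minimizer \<Omega> f g \<psi> u \<longleftrightarrow> variational_solution \<Omega> f g \<psi> u"
proof -
  define A where "A v = (LINT x|lebesgue_on \<Omega>. weak_grad \<Omega> u x \<bullet> weak_grad \<Omega> (\<lambda>y. v y - u y) x)
      - (LINT x|lebesgue_on \<Omega>. f x * (v x - u x))" for v
  define B where "B v = (LINT x|lebesgue_on \<Omega>. (norm (weak_grad \<Omega> (\<lambda>y. v y - u y) x))\<^sup>2)" for v
  have B: "0 \<le> B v" for v
    by (simp add: B_def)
  \<comment> \<open>The point (1 - t) u + t v of the segment is u + t (v - u), so \<open>A\<close>
    and \<open>B\<close> are the linear and quadratic coefficients in direction v - u.\<close>
  have expand: "energy \<Omega> f (\<lambda>x. (1 - t) * u x + t * v x) = energy \<Omega> f u + t * A v + t\<^sup>2 / 2 * B v"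
    if "v \<in> admissible \<Omega> g \<psi>" for v t
  proof -
    have H1: "u \<in> H1 \<Omega>" "v \<in> H1 \<Omega>"
      using that assms(3) by (auto simp: admissible_def dirichlet_class_def)
    have "(\<lambda>x. v x - u x) \<in> H1 \<Omega>"
      using H1_lincomb[OF assms(1) H1(2,1), of 1 "-1"] by simp
    from energy_expansion[OF assms(1,2) H1(1) this, of t] show ?thesis
      by (simp add: A_def B_def algebra_simps)
  qed
  have "(\<forall>v\<in>admissible \<Omega> g \<psi>. energy \<Omega> f u \<le> energy \<Omega> f v) \<longleftrightarrow> (\<forall>v\<in>admissible \<Omega> g \<psi>. 0 \<le> A v)"
  proof (intro iffI ballI)
    fix v assume min: "\<forall>v\<in>admissible \<Omega> g \<psi>. energy \<Omega> f u \<le> energy \<Omega> f v" and v: "v \<in> admissible \<Omega> g \<psi>"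
    have A: "0 \<le> A v + t / 2 * B v" if "0 < t" "t \<le> 1" for t
    proof -
      have "0 \<le> t * A v + t\<^sup>2 / 2 * B v"
        using min admissible_convex[OF assms(1,3) v, of t] that expand[OF v, of t] by force
      also have "\<dots> = t * (A v + t / 2 * B v)"
        by (simp add: power2_eq_square algebra_simps)
      finally show ?thesis
        using that(1) by (simp add: zero_le_mult_iff)
    qed
    have "((\<lambda>t. A v + t / 2 * B v) \<longlongrightarrow> A v + 0 / 2 * B v) (at_right 0)"
      by (intro tendsto_intros) simp
    moreover have "\<forall>\<^sub>F t in at_right (0::real). 0 \<le> A v + t / 2 * B v"
      using A by (auto simp: eventually_at_right_field intro!: exI[of _ 1])
    ultimately have "0 \<le> A v + 0 / 2 * B v"
      by (rule tendsto_lowerbound) simp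
    then show "0 \<le> A v"
      by simp
  next
    fix v assume "\<forall>v\<in>admissible \<Omega> g \<psi>. 0 \<le> A v" and v: "v \<in> admissible \<Omega> g \<psi>"
    \<comment> \<open>At t = 1 the expansion ends in v itself: I(v) = I(u) + A v + B v / 2 with B v
      \<ge> 0.\<close>
    then show "energy \<Omega> f u \<le> energy \<Omega> f v"
      using expand[OF v, of 1] B[of v] by simp
  qed
  then show ?thesis
    using assms(3) by (simp add: energy_minimizer_def variational_solution_def A_def)
qed

text \<open>The weak gradient of u is never compared with the classical one. Its defining identity
  first moves the derivative onto \<phi>; two classical integrations by parts then bring both
  derivatives back to u.\<close>

lemma integral_weak_grad_test_function:
  assumes "open \<Omega>" "u \<in> H1 \<Omega>" "Ck_on 2 \<Omega> u" "\<phi> \<in> test_functions \<Omega>"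
  shows "(LINT x|lebesgue_on \<Omega>. weak_grad \<Omega> u x \<bullet> weak_grad \<Omega> \<phi> x)
    = (LINT x|lebesgue_on \<Omega>. - laplacian u x * \<phi> x)"
proof -
  note w = weak_partial_H1[OF assms(2)]
  note p = test_functionsD(3)[OF assms(4)]
  have C: "\<And>x. x \<in> \<Omega> \<Longrightarrow> u differentiable (at x)"
    "\<And>i x. x \<in> \<Omega> \<Longrightarrow> partial_deriv i u differentiable (at x)"
    "\<And>i j. continuous_on \<Omega> (partial_deriv j (partial_deriv i u))"
    using assms(3) by (auto simp: numeral_2_eq_2)
  have C1: "continuous_on \<Omega> (partial_deriv i u)" for i
    using C(2) by (simp add: continuous_at_imp_continuous_on differentiable_imp_continuous_within)
  have int: "integrable (lebesgue_on \<Omega>) (\<lambda>x. weak_partial \<Omega> i u x * weak_partial \<Omega> i \<phi> x)" for i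
    using w weak_partial_H1[OF test_functions_H1[OF assms(1,4)]] by (intro L2_mult_integrable)
  have int': "integrable (lebesgue_on \<Omega>) (\<lambda>x. partial_deriv i (partial_deriv i u) x * \<phi> x)" for i
    using assms by (intro integrable_loc_mult_test loc_integrable_continuous C)
  have comp: "(LINT x|lebesgue_on \<Omega>. weak_partial \<Omega> i u x * weak_partial \<Omega> i \<phi> x)
      = - (LINT x|lebesgue_on \<Omega>. partial_deriv i (partial_deriv i u) x * \<phi> x)" for i
  proof -
    have "(LINT x|lebesgue_on \<Omega>. weak_partial \<Omega> i u x * weak_partial \<Omega> i \<phi> x)
        = (LINT x|lebesgue_on \<Omega>. weak_partial \<Omega> i u x * partial_deriv i \<phi> x)"
    proof (rule integral_cong_AE)
      show "AE x in lebesgue_on \<Omega>. weak_partial \<Omega> i u x * weak_partial \<Omega> i \<phi> x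
          = weak_partial \<Omega> i u x * partial_deriv i \<phi> x"
        using weak_partial_AE_eq[OF assms(1) test_functions_H1[OF assms(1,4)]
            test_functions_L2[OF assms(1) p] has_weak_partial_test_function[OF assms(1,4)], of i]
        by eventually_elim simp
      show "(\<lambda>x. weak_partial \<Omega> i u x * weak_partial \<Omega> i \<phi> x) \<in> borel_measurable (lebesgue_on \<Omega>)"
        by (rule borel_measurable_integrable[OF int])
      show "(\<lambda>x. weak_partial \<Omega> i u x * partial_deriv i \<phi> x) \<in> borel_measurable (lebesgue_on \<Omega>)"
        by (intro borel_measurable_integrable L2_mult_integrable w test_functions_L2 assms(1) p)
    qed
    also have "\<dots> = - (LINT x|lebesgue_on \<Omega>. u x * partial_deriv i (partial_deriv i \<phi>) x)"
      using w(2)[of i] p[of i] by (simp add: has_weak_partial_def)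
    also have "\<dots> = (LINT x|lebesgue_on \<Omega>. partial_deriv i u x * partial_deriv i \<phi> x)"
      using integral_by_parts_test[OF assms(1) C(1) C1 p, of i i] by simp
    also have "\<dots> = - (LINT x|lebesgue_on \<Omega>. partial_deriv i (partial_deriv i u) x * \<phi> x)"
      using integral_by_parts_test[OF assms(1) C(2) C(3) assms(4), of i i] by simp
    finally show ?thesis .
  qed
  have "(LINT x|lebesgue_on \<Omega>. weak_grad \<Omega> u x \<bullet> weak_grad \<Omega> \<phi> x)
      = (\<Sum>i\<in>UNIV. LINT x|lebesgue_on \<Omega>. weak_partial \<Omega> i u x * weak_partial \<Omega> i \<phi> x)"
    using int by (simp add: weak_grad_def inner_vec_def)
  also have "\<dots> = (LINT x|lebesgue_on \<Omega>. - laplacian u x * \<phi> x)"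
    using int' by (simp add: comp laplacian_def sum_distrib_right sum_negf)
  finally show ?thesis .
qed

lemma variational_solution_imp_complementarity_solution:
  assumes "open \<Omega>" "f \<in> L2 \<Omega>" "continuous_on \<Omega> \<psi>" "Ck_on 2 \<Omega> u"
    and var: "variational_solution \<Omega> f g \<psi> u"
  shows "complementarity_solution \<Omega> f \<psi> u"
proof -
  have adm: "u \<in> admissible \<Omega> g \<psi>"
    using var by (simp add: variational_solution_def)
  then have H1: "u \<in> H1 \<Omega>" and ge: "AE x in lebesgue_on \<Omega>. \<psi> x \<le> u x"
    by (auto simp: admissible_def dirichlet_class_def)
  have cu: "continuous_on \<Omega> u"
    using Ck_on_Suc_imp_Ck_on[of 0 \<Omega> u] Ck_on_Suc_imp_Ck_on[of 1 \<Omega> u] assms(4)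
    by (simp add: numeral_2_eq_2)
  have "continuous_on \<Omega> (partial_deriv i (partial_deriv i u))" for i
    using assms(4) by (auto simp: numeral_2_eq_2)
  then have "continuous_on \<Omega> (laplacian u)"
    unfolding laplacian_def by (intro continuous_intros)
  then have lap: "loc_integrable \<Omega> (\<lambda>x. - laplacian u x)"
    by (intro loc_integrable_minus loc_integrable_continuous)
  define h where "h x = - laplacian u x - f x" for x
  have loc: "loc_integrable \<Omega> h"
    unfolding h_def by (intro loc_integrable_diff lap loc_integrable_L2 assms)
  \<comment> \<open>The sign of \<phi> is left free and only u + \<phi> \<ge> \<psi> is required, so
    that upward and downward perturbations are both covered.\<close>
  have test: "0 \<le> (LINT x|lebesgue_on \<Omega>. h x * \<phi> x)"
    if \<phi>: "\<phi> \<in> test_functions \<Omega>" and "AE x in lebesgue_on \<Omega>. \<psi> x \<le> u x + \<phi> x" for \<phi>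
  proof -
    have "(\<lambda>x. u x + \<phi> x) \<in> admissible \<Omega> g \<psi>"
      by (rule admissible_add_test_function[OF assms(1) adm that])
    then have "(LINT x|lebesgue_on \<Omega>. f x * \<phi> x) \<le> (LINT x|lebesgue_on \<Omega>. weak_grad \<Omega> u x \<bullet> weak_grad \<Omega> \<phi> x)"
      using var by (auto simp: variational_solution_def)
    also have "\<dots> = (LINT x|lebesgue_on \<Omega>. - laplacian u x * \<phi> x)"
      by (rule integral_weak_grad_test_function[OF assms(1) H1 assms(4) \<phi>])
    finally have "0 \<le> (LINT x|lebesgue_on \<Omega>. - laplacian u x * \<phi> x) - (LINT x|lebesgue_on \<Omega>. f x * \<phi> x)"
      by simp
    also have "\<dots> = (LINT x|lebesgue_on \<Omega>. - laplacian u x * \<phi> x - f x * \<phi> x)"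
      using assms by (intro Bochner_Integration.integral_diff[symmetric] integrable_loc_mult_test lap loc_integrable_L2 \<phi>)
    finally show ?thesis
      by (simp add: h_def left_diff_distrib)
  qed
  have nonneg: "AE x in lebesgue_on \<Omega>. 0 \<le> h x"
  proof (rule AE_nonneg_if_test_integrals_nonneg[OF assms(1) loc])
    fix \<phi> assume \<phi>: "\<phi> \<in> test_functions \<Omega>" "\<And>x. 0 \<le> \<phi> x \<and> \<phi> x \<le> 1"
    have "AE x in lebesgue_on \<Omega>. \<psi> x \<le> u x + \<phi> x"
      using ge
    proof eventually_elim
      case (elim x)
      then show ?case using \<phi>(2)[of x] by linarith
    qed
    then show "0 \<le> (LINT x|lebesgue_on \<Omega>. h x * \<phi> x)"
      by (rule test[OF \<phi>(1)])
  qed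
  define S where "S = {x \<in> \<Omega>. \<psi> x < u x}"
  have "open (\<Omega> \<inter> (\<lambda>x. u x - \<psi> x) -` {0<..})"
    by (intro continuous_open_preimage continuous_intros cu assms open_greaterThan)
  also have "\<Omega> \<inter> (\<lambda>x. u x - \<psi> x) -` {0<..} = S"
    by (auto simp: S_def)
  finally have S: "open S" "S \<subseteq> \<Omega>"
    by (auto simp: S_def)
  have "AE x in lebesgue_on S. 0 \<le> - h x"
  proof (rule AE_nonneg_if_test_integrals_nonneg[OF S(1) loc_integrable_minus[OF loc_integrable_subset[OF loc S(2)]]])
    fix \<phi> assume \<phi>: "\<phi> \<in> test_functions S" "\<And>x. 0 \<le> \<phi> x \<and> \<phi> x \<le> 1"
    note T = test_functionsD[OF \<phi>(1)]
    define K where "K = closure {x. \<phi> x \<noteq> 0}"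
    have K: "compact K" "K \<subseteq> S" "\<And>x. x \<notin> K \<Longrightarrow> \<phi> x = 0"
      unfolding K_def using T(4-6) by blast+
    \<comment> \<open>The minimum of u - \<psi> over the compact support, positive because the
      support lies in S; any positive number, here 1, does if the support is empty.\<close>
    obtain \<delta> where \<delta>: "\<delta> > 0" "\<And>x. x \<in> K \<Longrightarrow> \<delta> \<le> u x - \<psi> x"
    proof (cases "K = {}")
      case True
      then show ?thesis using that[of 1] by simp
    next
      case False
      have "continuous_on K (\<lambda>x. u x - \<psi> x)"
        using K(2) S(2) cu assms(3) by (intro continuous_intros) (auto intro: continuous_on_subset)
      from continuous_attains_inf[OF K(1) False this]
      obtain z where z: "z \<in> K" "\<And>x. x \<in> K \<Longrightarrow> u z - \<psi> z \<le> u x - \<psi> x"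
        by blast
      have "\<psi> z < u z"
        using subsetD[OF K(2) z(1)] by (simp add: S_def)
      then show ?thesis
        using z(2) by (intro that[of "u z - \<psi> z"]) simp_all
    qed
    have \<phi>\<Omega>: "\<phi> \<in> test_functions \<Omega>"
      using \<phi>(1) S(2) by (auto simp: test_functions_def)
    have \<delta>\<phi>: "(\<lambda>x. - \<delta> * \<phi> x) \<in> test_functions \<Omega>"
      using test_functions_lincomb[OF \<phi>\<Omega> \<phi>\<Omega>, of "- \<delta>" 0] by simp
    have "AE x in lebesgue_on \<Omega>. \<psi> x \<le> u x + - \<delta> * \<phi> x"
      using ge
    proof eventually_elim
      case (elim x)
      show ?case
      proof (cases "x \<in> K")
        case True
        \<comment> \<open>Here \<phi> \<le> 1 enters: \<delta> \<phi> \<le> \<delta> \<le> u -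
          \<psi> on the support.\<close>
        then have "\<delta> * \<phi> x \<le> u x - \<psi> x"
          using \<delta>(1) \<delta>(2)[OF True] \<phi>(2)[of x] mult_left_le[of "\<phi> x" \<delta>] by linarith
        then show ?thesis by simp
      next
        case False
        then show ?thesis using elim K(3) by simp
      qed
    qed
    from test[OF \<delta>\<phi> this] have "0 \<le> - \<delta> * (LINT x|lebesgue_on \<Omega>. h x * \<phi> x)"
      by (simp add: mult.left_commute)
    then have "(LINT x|lebesgue_on \<Omega>. h x * \<phi> x) \<le> 0"
      using \<delta>(1) by (simp add: mult_le_0_iff)
    then show "0 \<le> (LINT x|lebesgue_on S. - h x * \<phi> x)"
      using integral_test_restrict[OF assms(1) S(2,1) \<phi>(1), of h] by simp
  qed
  then have "AE x in lebesgue. x \<in> S \<longrightarrow> h x \<le> 0"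
    using S(1) by (simp add: AE_restrict_space_iff)
  then have "AE x in lebesgue_on \<Omega>. x \<in> S \<longrightarrow> h x \<le> 0"
    using assms(1) by (simp add: AE_restrict_space_iff) (auto elim: eventually_mono)
  \<comment> \<open>Membership in \<Omega> is part of S, so it is needed to conclude u \<le> \<psi>,
    and with \<open>ge\<close> equality, at a point outside S.\<close>
  moreover have "AE x in lebesgue_on \<Omega>. x \<in> \<Omega>"
    using AE_space[of "lebesgue_on \<Omega>"] by simp
  ultimately show ?thesis
    unfolding complementarity_solution_def using nonneg ge
  proof eventually_elim
    case (elim x)
    show ?case
    proof (cases "x \<in> S")
      case True
      then show ?thesis using elim by (simp add: h_def)
    next
      case False
      then have "u x = \<psi> x" using elim by (simp add: S_def)
      then show ?thesis using elim by (simp add: h_def)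
    qed
  qed
qed

theorem theorem6:
  fixes \<Omega> :: "(real^2) set" and f \<psi> g\<^sub>D u :: "real^2 \<Rightarrow> real"
  assumes "bounded_domain \<Omega>"
    and "f \<in> L2 \<Omega>"
    and "continuous_on (closure \<Omega>) \<psi>"
    and "continuous_on (closure \<Omega>) g\<^sub>D"
    and "\<forall>x\<in>closure \<Omega>. g\<^sub>D x \<ge> \<psi> x"
    and "u \<in> admissible \<Omega> g\<^sub>D \<psi>"
  shows "(energy_minimizer \<Omega> f g\<^sub>D \<psi> u \<longleftrightarrow> variational_solution \<Omega> f g\<^sub>D \<psi> u) \<and>
    (continuous_on (closure \<Omega>) u \<and> Ck_on 2 \<Omega> u \<longrightarrow>
      energy_minimizer \<Omega> f g\<^sub>D \<psi> u \<or> variational_solution \<Omega> f g\<^sub>D \<psi> u \<longrightarrow>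
      complementarity_solution \<Omega> f \<psi> u)"
proof -
  have "open \<Omega>" "continuous_on \<Omega> \<psi>"
    using assms(1) continuous_on_subset[OF assms(3) closure_subset] by (simp_all add: bounded_domain_def)
  then show ?thesis
    using energy_minimizer_iff_variational_solution[OF _ assms(2,6)]
      variational_solution_imp_complementarity_solution[OF _ assms(2)] by blast
qed

end
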